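(* Let $Y$ be any of the spaces $\mathcal{LM}$, $\mathcal L L^1$, $\mathcal{LM}_d$, $\mathcal{LM}_s$, $\mathcal R_0$, $\mathcal J_0$. Then the closure of $Y$ in $\mathcal B$ with respect to the $\mathcal B$-norm coincides with the closure of $Y$ in $\mathcal B$ with respect to the sup norm $\|\cdot\|_\infty$. Moreover, if $Y$ is any of $\mathcal LL^1$, $\mathcal R_0$, $\mathcal J_0$, then the closure of $Y$ in $\mathcal B$ (for the $\mathcal B$-norm) is $\mathcal B\cap C_0(\overline{\mathbb C}_+)$.
   Context: $\mathbb C_+=\{z:\Re z>0\}$. $\mathcal B$ is the space of holomorphic $f$ on $\mathbb C_+$ with $\|f\|_{\mathcal B_0}:=\int_0^\infty\sup_{\beta\in\mathbb R}|f'(\alpha+i\beta)|\,d\alpha<\infty$; such $f$ are bounded and extend continuously to $\overline{\mathbb C}_+$; norm $\|f\|_{\mathcal B}=\|f\|_\infty+\|f\|_{\mathcal B_0}$. For a set $\mathcal N$ of bounded Borel measures on $\mathbb R_+=[0,\infty)$, $\mathcal{LN}=\{\mathcal L\mu:\mu\in\mathcal N\}$ with $\mathcal L\mu(z)=\int e^{-zt}d\mu(t)$; $M=M(\mathbb R_+)$ is all bounded Borel measures, $L^1$ the absolutely continuous ones, $M_d$ the discrete ones, $M_s$ the singular non-atomic ones. It is known that $\mathcal{LM}\subset\mathcal B$. $\mathcal R_0$ is the space of rational functions vanishing at infinity with no poles in $\overline{\mathbb C}_+$; $\mathcal J_0$ is the space of entire functions of exponential type belonging to $H^\infty(\mathbb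 C_+)\cap C_0(\overline{\mathbb C}_+)$. $C_0(\overline{\mathbb C}_+)$ denotes continuous functions on $\overline{\mathbb C}_+$ tending to $0$ as $|z|\to\infty$. *)

theory Defs
  imports "HOL-Analysis.Analysis" "HOL-Computational_Algebra.Polynomial"
begin

definition Cplus :: "complex set" where
  "Cplus = {z. Re z > 0}"

definition Cplus_cl :: "complex set" where
  "Cplus_cl = {z. Re z \<ge> 0}"

text \<open>Functions are represented as maps complex to complex; only their values on
  the open half-plane matter.  Sup norm over the open half-plane (ennreal valued).\<close>
definition sup_norm :: "(complex \<Rightarrow> complex) \<Rightarrow> ennreal" where
  "sup_norm f = (SUP z\<in>Cplus. ennreal (cmod (f z)))"

definition B0_norm :: "(complex \<Rightarrow> complex) \<Rightarrow> ennreal" where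
  "B0_norm f = (\<integral>\<^sup>+ \<alpha>. indicator {0<..} \<alpha> *
       (SUP \<beta>::real. ennreal (cmod (deriv f (Complex \<alpha> \<beta>)))) \<partial>lborel)"

definition B_space :: "(complex \<Rightarrow> complex) set" where
  "B_space = {f. f holomorphic_on Cplus \<and> B0_norm f < \<infinity>}"

definition B_norm :: "(complex \<Rightarrow> complex) \<Rightarrow> ennreal" where
  "B_norm f = sup_norm f + B0_norm f"

definition C0_cl :: "(complex \<Rightarrow> complex) \<Rightarrow> bool" where
  "C0_cl f \<longleftrightarrow> (\<exists>g. continuous_on Cplus_cl g \<and> (\<forall>z\<in>Cplus. g z = f z) \<and>
       (g \<longlongrightarrow> 0) (inf at_infinity (principal Cplus_cl)))"

definition closure_B :: "(complex \<Rightarrow> complex) set \<Rightarrow> (complex \<Rightarrow> complex) set" where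
  "closure_B Y = {g \<in> B_space. \<forall>\<epsilon>>0. \<exists>h\<in>Y. B_norm (\<lambda>z. g z - h z) < ennreal \<epsilon>}"

definition closure_sup :: "(complex \<Rightarrow> complex) set \<Rightarrow> (complex \<Rightarrow> complex) set" where
  "closure_sup Y = {g \<in> B_space. \<forall>\<epsilon>>0. \<exists>h\<in>Y. sup_norm (\<lambda>z. g z - h z) < ennreal \<epsilon>}"

text \<open>Finite positive Borel measures on the real line concentrated on [0,\<infinity>).
  Bounded complex Borel measures on R_+ are exactly the combinations
  M1 - M2 + i (M3 - M4) of such measures (Jordan decomposition); a complex measure
  is absolutely continuous / discrete / singular non-atomic iff its Jordan parts are.\<close>
definition pos_meas_Rplus :: "real measure \<Rightarrow> bool" where
  "pos_meas_Rplus M \<longleftrightarrow> sets M = sets borel \<and> finite_measure M \<and> emeasure M {..<0} = 0"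

definition laplace_pos :: "real measure \<Rightarrow> complex \<Rightarrow> complex" where
  "laplace_pos M z = (LINT t|M. exp (- (z * complex_of_real t)))"

definition laplace_class :: "(real measure \<Rightarrow> bool) \<Rightarrow> (complex \<Rightarrow> complex) set" where
  "laplace_class P = {(\<lambda>z. laplace_pos M1 z - laplace_pos M2 z
        + \<i> * (laplace_pos M3 z - laplace_pos M4 z)) | M1 M2 M3 M4.
     (\<forall>M\<in>{M1, M2, M3, M4}. pos_meas_Rplus M \<and> P M)}"

definition LM :: "(complex \<Rightarrow> complex) set" where
  "LM = laplace_class (\<lambda>M. True)"

definition LL1 :: "(complex \<Rightarrow> complex) set" where
  "LL1 = laplace_class (\<lambda>M. absolutely_continuous lborel M)"

definition LMd :: "(complex \<Rightarrow> complex) set" where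
  "LMd = laplace_class (\<lambda>M. \<exists>A. countable A \<and> emeasure M (UNIV - A) = 0)"

definition LMs :: "(complex \<Rightarrow> complex) set" where
  "LMs = laplace_class (\<lambda>M. (\<exists>N\<in>sets borel. emeasure lborel N = 0 \<and> emeasure M (UNIV - N) = 0)
                            \<and> (\<forall>x. emeasure M {x} = 0))"

definition R0 :: "(complex \<Rightarrow> complex) set" where
  "R0 = {(\<lambda>z. poly p z / poly q z) | p q. degree p < degree q \<and>
                                        (\<forall>z\<in>Cplus_cl. poly q z \<noteq> 0)}"

definition J0 :: "(complex \<Rightarrow> complex) set" where
  "J0 = {f. f holomorphic_on UNIV \<and> (\<exists>A B. \<forall>z. cmod (f z) \<le> A * exp (B * cmod z)) \<and>
            bounded (f ` Cplus) \<and> C0_cl f}"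

end

theory Submission
  imports Defs "HOL-Complex_Analysis.Complex_Analysis" "HOL-Probability.Distributions"
    "HOL-Real_Asymp.Real_Asymp"
begin

text \<open>
  Let \<open>T f = f(\<cdot> + \<delta>) - f(\<cdot> + n)\<close>. By Cauchy's estimates \<open>|(T f)'(z)| \<le> 16 n \<parallel>f\<parallel>\<^sub>\<infinity> / (Re z + \<delta>)\<^sup>2\<close>,
  so \<open>T\<close> is bounded from the sup norm to the norm of \<open>\<B>\<close>. Every \<open>g \<in> \<B>\<close> has a limit \<open>c\<close> at
  infinity along the real direction and \<open>T g + c \<rightarrow> g\<close> in \<open>\<B>\<close> as \<open>\<delta> \<rightarrow> 0\<close>, \<open>n \<rightarrow> \<infinity>\<close>: by the
  maximum principle \<open>sup\<^sub>\<beta> |g'(\<alpha> + i\<beta>)|\<close> decreases in \<open>\<alpha>\<close>, so dominated convergence applies. Each of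
  the six spaces is stable under \<open>h \<mapsto> T h + h(\<infinity>)\<close>, so a sup norm approximation \<open>h\<close> of \<open>g\<close> can be
  replaced by the approximation \<open>T h + h(\<infinity>)\<close> in \<open>\<B>\<close>.

  For the second part, the Cayley transform carries holomorphic functions in \<open>C\<^sub>0\<close> to the disc
  algebra, where polynomials are dense; they become polynomials in \<open>1 / (1 + z)\<close> without constant
  term. These are rational and are Laplace transforms of \<open>L\<^sup>1\<close> functions, and truncating the \<open>L\<^sup>1\<close>
  functions makes the transforms entire of exponential type. Conversely, uniform limits of
  functions vanishing at infinity vanish at infinity; for \<open>\<L>L\<^sup>1\<close> this uses the Riemann-Lebesgue
  lemma.
\<close>

section \<open>Limits and integrals\<close>

lemma ennreal_Lim_null_comparison:
  fixes f g :: "'a \<Rightarrow> ennreal"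
  assumes "(g \<longlongrightarrow> 0) F" "\<forall>\<^sub>F x in F. f x \<le> g x"
  shows "(f \<longlongrightarrow> 0) F"
  by (rule tendsto_sandwich[OF _ assms(2) tendsto_const assms(1)]) simp

lemma nn_integral_indicator_tendsto_0:
  assumes v: "v \<in> borel_measurable M" "(\<integral>\<^sup>+ x. v x \<partial>M) < \<infinity>" and A: "\<And>n. A n \<in> sets M"
    and leaves: "\<And>x. v x \<noteq> 0 \<Longrightarrow> \<forall>\<^sub>F n in sequentially. x \<notin> A n"
  shows "(\<lambda>n. \<integral>\<^sup>+ x. v x * indicator (A n) x \<partial>M) \<longlonglongrightarrow> 0"
proof -
  have "(\<lambda>n. v x * indicator (A n) x) \<longlonglongrightarrow> 0" for x
  proof (cases "v x = 0")
    case False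
    show ?thesis
      by (rule tendsto_eventually, use leaves[OF False] in eventually_elim) simp
  qed simp
  then have "(\<lambda>n. \<integral>\<^sup>+ x. v x * indicator (A n) x \<partial>M) \<longlonglongrightarrow> (\<integral>\<^sup>+ x. 0 \<partial>M)"
    using v A by (intro nn_integral_dominated_convergence[where w = v]) (auto simp: indicator_def)
  then show ?thesis by simp
qed

lemma nn_integral_inverse_square:
  assumes "\<delta> > 0"
  shows "(\<integral>\<^sup>+ \<alpha>. ennreal (1 / (\<alpha> + \<delta>)\<^sup>2) * indicator {0..} \<alpha> \<partial>lborel) = ennreal (1 / \<delta>)"
proof -
  have "(\<integral>\<^sup>+ \<alpha>. ennreal (1 / (\<alpha> + \<delta>)\<^sup>2) * indicator {0..} \<alpha> \<partial>lborel)
      = ennreal (0 - (- 1 / (0 + \<delta>)))"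
  proof (rule nn_integral_FTC_atLeast)
    show "((\<lambda>\<alpha>. - 1 / (\<alpha> + \<delta>)) has_real_derivative 1 / (x + \<delta>)\<^sup>2) (at x)" if "0 \<le> x" for x
      using that assms by (auto intro!: derivative_eq_intros simp: power2_eq_square)
    show "((\<lambda>\<alpha>. - 1 / (\<alpha> + \<delta>)) \<longlongrightarrow> 0) at_top" by real_asymp
  qed (use assms in auto)
  then show ?thesis by simp
qed

lemma integral_norm_diff_tendsto_0:
  fixes f :: "'a \<Rightarrow> 'b::{banach, second_countable_topology}"
  assumes f: "f \<in> borel_measurable M" and s: "\<And>i. s i \<in> borel_measurable M" and w: "integrable M w"
    and lim: "\<And>x. (\<lambda>i. s i x) \<longlonglongrightarrow> f x" and bound: "\<And>i x. norm (s i x) \<le> w x"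
  shows "(\<lambda>i. LINT x|M. norm (s i x - f x)) \<longlonglongrightarrow> 0"
proof -
  have "norm (f x) \<le> w x" for x
    using tendsto_norm[OF lim[of x]] bound by (intro tendsto_upperbound) auto
  then have "norm (s i x - f x) \<le> 2 * w x" for i x
    using norm_triangle_ineq4[of "s i x" "f x"] bound[of i x] by (smt (verit))
  moreover have "(\<lambda>i. norm (s i x - f x)) \<longlonglongrightarrow> 0" for x
    using lim by (intro tendsto_norm_zero) (simp add: Lim_null[symmetric])
  ultimately have "(\<lambda>i. LINT x|M. norm (s i x - f x)) \<longlonglongrightarrow> (LINT x|M. 0)"
    using f s w by (intro integral_dominated_convergence[where w = "\<lambda>x. 2 * w x"]) auto
  then show ?thesis by simp
qed

lemma set_integral_exp_Icc:
  fixes s :: complex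
  assumes "s \<noteq> 0" "a \<le> b"
  shows
    "(LINT t:{a..b}|lborel. exp (- (s * of_real t)))
        = (exp (- (s * of_real a)) - exp (- (s * of_real b))) / s"
proof -
  have "((\<lambda>w. - (exp (- (s * w)) / s))
      has_field_derivative exp (- (s * of_real t))) (at (of_real t))" for t
    using assms(1) by (auto intro!: derivative_eq_intros)
  then have
    "((\<lambda>t. - (exp (- (s * complex_of_real t)) / s)) has_vector_derivative exp (- (s * of_real t)))
      (at t within {a..b})" for t
    by (rule has_vector_derivative_real_field[THEN has_vector_derivative_at_within])
  then have "(LINT t:{a..b}|lborel. exp (- (s * of_real t)))
      = - (exp (- (s * of_real b)) / s) - (- (exp (- (s * of_real a)) / s))"
    unfolding set_lebesgue_integral_def
    using assms(2) by (intro integral_FTC_Icc) (auto intro!: continuous_intros)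
  then show ?thesis by (simp add: diff_divide_distrib)
qed

lemma integrable_erlang_density:
  assumes "l > 0"
  shows "integrable lborel (erlang_density k l)"
  using nn_integral_erlang_ith_moment[OF assms, of k 0] assms by (intro integrableI_nonneg) auto

lemma emeasure_eq_0_absolutely_continuous:
  assumes "absolutely_continuous M N" "A \<in> sets M" "emeasure M A = 0"
  shows "emeasure N A = 0"
  using assms by (auto simp: absolutely_continuous_def null_sets_def)

lemma uniform_limit_uniformly_continuous_on:
  fixes f :: "'a::metric_space \<Rightarrow> 'b::metric_space"
  assumes cont: "\<forall>\<^sub>F n in F. uniformly_continuous_on S (s n)" and lim: "uniform_limit S s f F"
    and F: "F \<noteq> bot"
  shows "uniformly_continuous_on S f"
  unfolding uniformly_continuous_on_def
proof (intro allI impI)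
  fix e :: real assume "e > 0"
  then have "\<forall>\<^sub>F n in F. uniformly_continuous_on S (s n) \<and> (\<forall>x\<in>S. dist (s n x) (f x) < e / 3)"
    using uniform_limitD[OF lim, of "e / 3"] cont by (auto intro: eventually_conj)
  then obtain n where n: "uniformly_continuous_on S (s n)" "\<And>x. x \<in> S \<Longrightarrow> dist (s n x) (f x) < e / 3"
    using F by (auto dest: eventually_happens')
  then obtain d
    where d: "d > 0" "\<And>x x'. x \<in> S \<Longrightarrow> x' \<in> S \<Longrightarrow> dist x' x < d \<Longrightarrow> dist (s n x') (s n x) < e / 3"
    using \<open>e > 0\<close> uniformly_continuous_onE[of S "s n" "e / 3"] by auto
  have "dist (f x') (f x) < e" if "x \<in> S" "x' \<in> S" "dist x' x < d" for x x'
    using n(2)[OF that(1)] n(2)[OF that(2)] d(2)[OF that]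
      dist_triangle[of "f x'" "f x" "s n x"] dist_triangle3[of "f x'" "s n x" "s n x'"] by simp
  with d(1) show "\<exists>d>0. \<forall>x\<in>S. \<forall>x'\<in>S. dist x' x < d \<longrightarrow> dist (f x') (f x) < e" by blast
qed

abbreviation at_infinity_within :: "'a::real_normed_vector set \<Rightarrow> 'a filter" where
  "at_infinity_within S \<equiv> inf at_infinity (principal S)"

lemma tendsto_0_at_infinity_closure:
  fixes g :: "'a::real_normed_vector \<Rightarrow> 'b::real_normed_vector"
  assumes cont: "continuous_on (closure S) g" and lim: "(g \<longlongrightarrow> 0) (at_infinity_within S)"
  shows "(g \<longlongrightarrow> 0) (at_infinity_within (closure S))"
proof (rule tendstoI)
  fix e :: real assume "e > 0"
  then have "\<forall>\<^sub>F z in at_infinity_within S. dist (g z) 0 < e / 2" using lim by (intro tendstoD) auto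
  then obtain R where R: "\<And>z. z \<in> S \<Longrightarrow> norm z \<ge> R \<Longrightarrow> norm (g z) < e / 2"
    by (auto simp: eventually_inf_principal eventually_at_infinity)
  let ?T = "{z. R < norm z} \<inter> S"
  have "norm (g z) < e" if "z \<in> closure S" "norm z \<ge> R + 1" for z
  proof -
    have "open {z::'a. R < norm z}" by (intro open_Collect_less continuous_intros)
    then have "z \<in> closure ?T" using that open_Int_closure_subset by fastforce
    moreover have "continuous_on (closure ?T) g"
      by (rule continuous_on_subset[OF cont]) (intro closure_mono, blast)
    moreover have "\<forall>z\<in>?T. norm (g z) \<le> e / 2" using R by (auto intro: less_imp_le)
    ultimately have "norm (g z) \<le> e / 2" by (intro continuous_on_closure_norm_le) auto
    with \<open>e > 0\<close> show ?thesis by simp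
  qed
  then show "\<forall>\<^sub>F z in at_infinity_within (closure S). dist (g z) 0 < e"
    by (auto simp: eventually_inf_principal eventually_at_infinity intro!: exI[of _ "R + 1"])
qed

section \<open>Density of step functions in \<open>L\<^sup>1\<close>\<close>

context
  fixes P :: "(real \<Rightarrow> 'a::{banach, second_countable_topology}) \<Rightarrow> bool"
  assumes interval: "\<And>a b c. P (\<lambda>t. indicator {a..b} t *\<^sub>R c)"
    and add: "\<And>f g. integrable lborel f \<Longrightarrow> P f \<Longrightarrow> integrable lborel g \<Longrightarrow> P g \<Longrightarrow> P (\<lambda>t. f t + g t)"
    and limit: "\<And>f s. integrable lborel f \<Longrightarrow> (\<And>i. integrable lborel (s i)) \<Longrightarrow> (\<And>i. P (s i)) \<Longrightarrow>
      (\<lambda>i. LINT t|lborel. norm (s i t - f t)) \<longlonglongrightarrow> 0 \<Longrightarrow> P f"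
begin

lemma dominated_limit_closed:
  assumes f: "integrable lborel f" and s: "\<And>i. integrable lborel (s i)" "\<And>i. P (s i)"
    and w: "integrable lborel w" and lim: "\<And>x. (\<lambda>i. s i x) \<longlonglongrightarrow> f x" "\<And>i x. norm (s i x) \<le> w x"
  shows "P f"
  by (rule limit[where s = s, OF f s])
    (intro integral_norm_diff_tendsto_0[OF _ _ w lim] borel_measurable_integrable f s)

lemma indicator_limit_closed:
  assumes B: "B \<in> sets lborel" "emeasure lborel B < \<infinity>"
    and A: "\<And>i. A i \<in> sets lborel" "\<And>i. A i \<subseteq> B" "\<And>i. P (\<lambda>t. indicator (A i) t *\<^sub>R c)"
    and L: "L \<in> sets lborel" "L \<subseteq> B" "\<And>t. (\<lambda>i. indicator (A i) t :: real) \<longlonglongrightarrow> indicator L t"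
  shows "P (\<lambda>t. indicator L t *\<^sub>R c)"
proof (rule dominated_limit_closed[where s = "\<lambda>i t. indicator (A i) t *\<^sub>R c"
      and w = "\<lambda>t. indicator B t * norm c"])
  have integrable: "integrable lborel (\<lambda>t. indicator S t *\<^sub>R c)" if "S \<in> sets lborel" "S \<subseteq> B" for S
    using that le_less_trans[OF emeasure_mono[OF that(2) B(1)] B(2)]
    by (intro integrable_scaleR_left) (simp add: integrable_indicator_iff)
  show "integrable lborel (\<lambda>t. indicator L t *\<^sub>R c)" using L by (intro integrable)
  show "integrable lborel (\<lambda>t. indicator (A i) t *\<^sub>R c)" for i using A by (intro integrable)
  show "integrable lborel (\<lambda>t. indicator B t * norm c)"
    using B by (intro integrable_mult_left) (simp add: integrable_indicator_iff)
  show "norm (indicator (A i) t *\<^sub>R c) \<le> indicator B t * norm c" for i t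
    using A(2)[of i] by (auto simp: indicator_def)
qed (intro A tendsto_scaleR L tendsto_const)+

lemma integrable_bounded_indicator:
  fixes A :: "real set"
  assumes "A \<in> sets borel"
  shows "integrable lborel (\<lambda>t. indicator (A \<inter> {- K..K}) t *\<^sub>R (c::'a))"
proof -
  have "emeasure lborel (A \<inter> {- K..K}) \<le> emeasure lborel {- K..K}"
    by (intro emeasure_mono) simp_all
  also have "\<dots> < \<infinity>" by (simp add: emeasure_lborel_Icc_eq)
  finally show ?thesis
    using assms by (intro integrable_scaleR_left) (simp add: integrable_indicator_iff)
qed

lemma disjoint_Un_indicator_closed:
  assumes "A \<in> sets borel" "B \<in> sets borel" "A \<inter> B = {}"
    and "P (\<lambda>t. indicator (A \<inter> {- K..K}) t *\<^sub>R c)" "P (\<lambda>t. indicator (B \<inter> {- K..K}) t *\<^sub>R c)"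
  shows "P (\<lambda>t. indicator ((A \<union> B) \<inter> {- K..K}) t *\<^sub>R c)"
proof -
  have "P (\<lambda>t. indicator (A \<inter> {- K..K}) t *\<^sub>R c + indicator (B \<inter> {- K..K}) t *\<^sub>R c)"
    using assms by (intro add integrable_bounded_indicator)
  moreover have "indicator (A \<inter> {- K..K}) t *\<^sub>R c + indicator (B \<inter> {- K..K}) t *\<^sub>R c
      = indicator ((A \<union> B) \<inter> {- K..K}) t *\<^sub>R c" for t
    using \<open>A \<inter> B = {}\<close> by (auto simp: indicator_def)
  ultimately show ?thesis by simp
qed

lemma compl_indicator_closed:
  assumes "A \<in> sets borel" "P (\<lambda>t. indicator (A \<inter> {- K..K}) t *\<^sub>R (- c))"
  shows "P (\<lambda>t. indicator ((UNIV - A) \<inter> {- K..K}) t *\<^sub>R c)"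
proof -
  have "P (\<lambda>t. indicator (UNIV \<inter> {- K..K}) t *\<^sub>R c + indicator (A \<inter> {- K..K}) t *\<^sub>R (- c))"
    using assms interval by (intro add integrable_bounded_indicator) auto
  moreover have "indicator (UNIV \<inter> {- K..K}) t *\<^sub>R c + indicator (A \<inter> {- K..K}) t *\<^sub>R (- c)
      = indicator ((UNIV - A) \<inter> {- K..K}) t *\<^sub>R c" for t
    by (auto simp: indicator_def)
  ultimately show ?thesis by simp
qed

lemma disjoint_UN_indicator_closed:
  fixes A :: "nat \<Rightarrow> real set"
  assumes A: "\<And>i. A i \<in> sets borel" "disjoint_family A"
    and P_A: "\<And>i. P (\<lambda>t. indicator (A i \<inter> {- K..K}) t *\<^sub>R c)"
  shows "P (\<lambda>t. indicator ((\<Union>i. A i) \<inter> {- K..K}) t *\<^sub>R c)"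
proof (rule indicator_limit_closed[where A = "\<lambda>n. (\<Union>i<n. A i) \<inter> {- K..K}" and B = "{- K..K}"])
  show "P (\<lambda>t. indicator ((\<Union>i<n. A i) \<inter> {- K..K}) t *\<^sub>R c)" for n
  proof (induction n)
    case 0
    show ?case using interval[of 1 0] by simp
  next
    case (Suc n)
    have "A i \<inter> A n = {}" if "i < n" for i
      using disjoint_family_onD[OF A(2), of i n] that by simp
    then have "(\<Union>i<n. A i) \<inter> A n = {}" by blast
    moreover have "(\<Union>i<n. A i) \<in> sets borel" using A(1) by auto
    ultimately have "P (\<lambda>t. indicator (((\<Union>i<n. A i) \<union> A n) \<inter> {- K..K}) t *\<^sub>R c)"
      using A(1) Suc P_A by (intro disjoint_Un_indicator_closed)
    then show ?case by (simp add: lessThan_Suc Un_commute)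
  qed
  show "(\<lambda>n. indicator ((\<Union>i<n. A i) \<inter> {- K..K}) t :: real) \<longlonglongrightarrow> indicator ((\<Union>i. A i) \<inter> {- K..K}) t"
    for t
    using tendsto_mult[OF LIMSEQ_indicator_UN[of A t] tendsto_const[of "indicator {- K..K} t"]]
    by (simp add: indicator_inter_arith)
  show "(\<Union>i<n. A i) \<inter> {- K..K} \<in> sets lborel" "(\<Union>i. A i) \<inter> {- K..K} \<in> sets lborel" for n
    using A(1) by auto
  show "emeasure lborel {- K..K} < \<infinity>" by (simp add: emeasure_lborel_Icc_eq)
qed auto

lemma bounded_indicator_closed:
  assumes "A \<in> sets borel"
  shows "P (\<lambda>t. indicator (A \<inter> {- K..K}) t *\<^sub>R c)"
proof -
  have borel: "(sets borel :: real set set) = sigma_sets UNIV (range (\<lambda>a. {..a}))"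
    by (subst borel_eq_atMost) simp
  have "Int_stable (range (\<lambda>a::real. {..a}))"
    by (auto simp: Int_stable_def intro!: image_eqI[of _ _ "min _ _"])
  moreover have "range (\<lambda>a::real. {..a}) \<subseteq> Pow UNIV" by simp
  moreover have "A \<in> sigma_sets UNIV (range (\<lambda>a. {..a}))" using assms borel by simp
  ultimately have "\<forall>c. P (\<lambda>t. indicator (A \<inter> {- K..K}) t *\<^sub>R c)"
  proof (induction rule: sigma_sets_induct_disjoint)
    case (basic A)
    then obtain a where "A = {..a}" by auto
    then have "A \<inter> {- K..K} = {- K..min a K}" by auto
    then show ?case by (simp add: interval)
  next
    case empty
    show ?case using interval[of 1 0] by simp
  next
    case (compl A)
    then show ?case using borel by (auto intro!: compl_indicator_closed)
  next
    case (union A)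
    then show ?case using borel by (auto intro!: disjoint_UN_indicator_closed)
  qed
  then show ?thesis ..
qed

lemma integrable_lborel_induct:
  assumes "integrable lborel u"
  shows "P u"
  using assms
proof induction
  case (base A c)
  show ?case
  proof (rule indicator_limit_closed[where A = "\<lambda>n. A \<inter> {- real n..real n}"])
    show "P (\<lambda>t. indicator (A \<inter> {- real n..real n}) t *\<^sub>R c)" for n
      using base by (intro bounded_indicator_closed) simp
    show "(\<lambda>n. indicator (A \<inter> {- real n..real n}) t :: real) \<longlonglongrightarrow> indicator A t" for t
    proof (rule tendsto_eventually)
      show "\<forall>\<^sub>F n in sequentially. (indicator (A \<inter> {- real n..real n}) t :: real) = indicator A t"
        using eventually_ge_at_top[of "nat \<lceil>\<bar>t\<bar>\<rceil>"] by eventually_elim (auto simp: indicator_def)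
    qed
  qed (use base in auto)
next
  case (lim f s)
  show ?case
  proof (rule dominated_limit_closed[where s = s and w = "\<lambda>x. 2 * norm (f x)"])
    show "integrable lborel (\<lambda>x. 2 * norm (f x))" using lim by auto
  qed (use lim in simp_all)
qed (intro add)

end

section \<open>Bounded holomorphic functions\<close>

lemma norm_deriv_le_of_bounded:
  assumes f: "f holomorphic_on S" and bound: "\<And>w. w \<in> S \<Longrightarrow> cmod (f w) \<le> G"
    and r: "r > 0" "cball z r \<subseteq> S"
  shows "cmod (deriv f z) \<le> G / r"
proof -
  have "cmod ((deriv ^^ 1) f z) \<le> fact 1 * G / r ^ 1"
  proof (rule Cauchy_inequality)
    show "f holomorphic_on ball z r"
      using f r ball_subset_cball by (blast intro: holomorphic_on_subset)
    show "continuous_on (cball z r) f"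
      using f r by (blast intro: holomorphic_on_imp_continuous_on holomorphic_on_subset)
    show "cmod (f w) \<le> G" if "cmod (z - w) = r" for w
      using that r by (intro bound) (auto simp: dist_norm subset_iff)
  qed (fact r)
  then show ?thesis by simp
qed

lemma bounded_holomorphic_lipschitz_on:
  assumes S: "open S" and f: "f holomorphic_on S"
    and bound: "\<And>w. w \<in> S \<Longrightarrow> cmod (f w) \<le> G" and "G \<ge> 0"
    and T: "convex T" and r: "r > 0" "\<And>z. z \<in> T \<Longrightarrow> cball z r \<subseteq> S"
  shows "(G / r)-lipschitz_on T f"
proof (rule lipschitz_onI)
  fix x y assume "x \<in> T" "y \<in> T"
  have "cmod (f x - f y) \<le> G / r * cmod (x - y)"
  proof (rule field_differentiable_bound[OF T])
    fix z assume z: "z \<in> T"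
    then have "z \<in> S" using r by force
    then show "(f has_field_derivative deriv f z) (at z within T)"
      by (rule holomorphic_derivI[OF f S])
    show "cmod (deriv f z) \<le> G / r"
      using z by (intro norm_deriv_le_of_bounded[OF f bound] r)
  qed fact+
  then show "dist (f x) (f y) \<le> G / r * dist x y" by (simp add: dist_norm)
qed (use \<open>G \<ge> 0\<close> r in simp)

lemma half_disc_maximum_modulus:
  assumes hol: "f holomorphic_on {z. a < Re z}" and cont: "continuous_on {z. a \<le> Re z} f"
    and line: "\<And>z. Re z = a \<Longrightarrow> cmod (f z) \<le> B"
    and arc: "\<And>z. a \<le> Re z \<Longrightarrow> cmod (z - of_real a) = R \<Longrightarrow> cmod (f z) \<le> B"
    and z: "a \<le> Re z" "cmod (z - of_real a) \<le> R"
  shows "cmod (f z) \<le> B"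
proof -
  define D where "D = {w. a \<le> Re w} \<inter> cball (of_real a) R"
  have "closed D" unfolding D_def by (intro closed_Int closed_halfspace_Re_ge closed_cball)
  have interior: "interior D = {w. a < Re w} \<inter> ball (of_real a) R"
    unfolding D_def interior_Int
    using interior_halfspace_ge[of "1::complex" a] by (simp add: inner_complex_def)
  show ?thesis
  proof (rule maximum_modulus_frontier[of f D])
    show "f holomorphic_on interior D"
      unfolding interior by (intro holomorphic_on_subset[OF hol]) auto
    show "continuous_on (closure D) f"
      unfolding closure_closed[OF \<open>closed D\<close>]
      by (intro continuous_on_subset[OF cont]) (auto simp: D_def)
    show "z \<in> D" using z by (simp add: D_def dist_norm norm_minus_commute)
    fix w assume "w \<in> frontier D"
    then have "w \<in> D" "w \<notin> {w. a < Re w} \<inter> ball (of_real a) R"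
      using \<open>closed D\<close> interior by (auto simp: frontier_def)
    then have "a \<le> Re w" "Re w = a \<or> cmod (w - of_real a) = R"
      by (auto simp: D_def dist_norm norm_minus_commute)
    then show "cmod (f w) \<le> B" using line arc by blast
  qed (simp add: D_def bounded_Int)
qed

text \<open>The powers of \<open>f\<close> absorb the factor \<open>1 + z - a\<close>, whose growth makes the maximum principle
  applicable on large half discs.\<close>

lemma norm_power_le_half_plane:
  assumes hol: "f holomorphic_on {z. a < Re z}" and cont: "continuous_on {z. a \<le> Re z} f"
    and M: "\<And>z. a \<le> Re z \<Longrightarrow> cmod (f z) \<le> M"
    and B: "\<And>z. Re z = a \<Longrightarrow> cmod (f z) \<le> B" "B > 0" and z: "a \<le> Re z"
  shows "cmod (f z) ^ n \<le> B ^ n * cmod (1 + (z - of_real a))"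
proof -
  define F where "F w = f w ^ n / (1 + (w - of_real a))" for w
  define R where "R = max (cmod (z - of_real a)) (M ^ n / B ^ n)"
  have nonzero: "1 + (w - of_real a) \<noteq> 0" and norm_ge_1: "1 \<le> cmod (1 + (w - of_real a))"
    if "a \<le> Re w" for w
  proof -
    show "1 \<le> cmod (1 + (w - of_real a))"
      using that complex_Re_le_cmod[of "1 + (w - of_real a)"] by simp
    then show "1 + (w - of_real a) \<noteq> 0" by auto
  qed
  have F_le_iff: "cmod (F w) \<le> B ^ n \<longleftrightarrow> cmod (f w) ^ n \<le> B ^ n * cmod (1 + (w - of_real a))"
    if "a \<le> Re w" for w
    using nonzero[OF that] by (simp add: F_def norm_divide norm_power divide_le_eq)
  have "cmod (F z) \<le> B ^ n"
  proof (rule half_disc_maximum_modulus[of F a _ R])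
    show "F holomorphic_on {z. a < Re z}" "continuous_on {z. a \<le> Re z} F"
      unfolding F_def using nonzero by (auto intro!: holomorphic_intros continuous_intros hol cont)
    show "cmod (F w) \<le> B ^ n" if "Re w = a" for w
    proof -
      have "cmod (f w) ^ n * 1 \<le> B ^ n * cmod (1 + (w - of_real a))"
        using B that norm_ge_1[of w] by (intro mult_mono power_mono) auto
      then show ?thesis using that by (simp add: F_le_iff)
    qed
    show "cmod (F w) \<le> B ^ n" if w: "a \<le> Re w" "cmod (w - of_real a) = R" for w
    proof -
      have "cmod (f w) ^ n \<le> M ^ n" using M w by (intro power_mono) auto
      also have "\<dots> = B ^ n * (M ^ n / B ^ n)" using B by simp
      also have "\<dots> \<le> B ^ n * cmod (w - of_real a)"
        using w B by (intro mult_left_mono) (auto simp: R_def)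
      also have "cmod (w - of_real a) \<le> cmod (1 + (w - of_real a))"
        using w unfolding cmod_def by (auto intro!: real_sqrt_le_mono power_mono)
      finally show ?thesis using B w by (simp add: F_le_iff mult_left_mono)
    qed
  qed (use z in \<open>auto simp: R_def\<close>)
  then show ?thesis using z by (simp add: F_le_iff)
qed

lemma half_plane_maximum_modulus:
  assumes hol: "f holomorphic_on {z. a < Re z}" and cont: "continuous_on {z. a \<le> Re z} f"
    and bounded: "bounded (f ` {z. a \<le> Re z})"
    and B: "\<And>z. Re z = a \<Longrightarrow> cmod (f z) \<le> B" and z: "a \<le> Re z"
  shows "cmod (f z) \<le> B"
proof (rule dense_ge)
  fix B' assume "B < B'"
  then have B': "\<And>z. Re z = a \<Longrightarrow> cmod (f z) \<le> B'" "B' > 0"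
    using B order_trans[OF norm_ge_zero B[of "of_real a"]] by force+
  obtain M where "\<forall>w \<in> f ` {z. a \<le> Re z}. cmod w \<le> M"
    using bounded by (auto simp only: bounded_iff)
  then have M: "\<And>z. a \<le> Re z \<Longrightarrow> cmod (f z) \<le> M" by simp
  show "cmod (f z) \<le> B'"
  proof (rule ccontr)
    assume "\<not> cmod (f z) \<le> B'"
    then have "cmod (f z) / B' > 1" using B' by simp
    then obtain n where "cmod (1 + (z - of_real a)) < (cmod (f z) / B') ^ n"
      using real_arch_pow by blast
    moreover have "cmod (f z) ^ n \<le> B' ^ n * cmod (1 + (z - of_real a))"
      by (rule norm_power_le_half_plane[OF hol cont M B' z])
    ultimately show False using B' by (simp add: power_divide field_simps)
  qed
qed

lemma has_field_derivative_integral_lipschitz: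
  fixes f :: "'b::{real_normed_field, banach, second_countable_topology} \<Rightarrow> 'a \<Rightarrow> 'b"
  assumes U: "open U" "z \<in> U" and int: "\<And>y. y \<in> U \<Longrightarrow> integrable M (f y)"
    and deriv: "\<And>t. t \<in> space M \<Longrightarrow> ((\<lambda>y. f y t) has_field_derivative f' t) (at z)"
    and lip: "AE t in M. (w t)-lipschitz_on U (\<lambda>y. f y t)" and w: "integrable M w"
  shows "((\<lambda>y. LINT t|M. f y t) has_field_derivative (LINT t|M. f' t)) (at z)"
proof -
  define Q where "Q y t = (f y t - f z t) / (y - z)" for y t
  have "((\<lambda>y. ((LINT t|M. f y t) - (LINT t|M. f z t)) / (y - z))
      \<longlongrightarrow> (LINT t|M. f' t)) (at z within U)"
    unfolding tendsto_at_iff_sequentially o_def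
  proof (intro allI impI)
    fix X assume X: "\<forall>i. X i \<in> U - {z}" "X \<longlonglongrightarrow> z"
    have lim: "(\<lambda>i. Q (X i) t) \<longlonglongrightarrow> f' t" if "t \<in> space M" for t
      using deriv[OF that] X
      unfolding has_field_derivative_iff tendsto_at_iff_sequentially o_def Q_def by blast
    have Q_meas: "Q (X i) \<in> borel_measurable M" for i
      using X(1) int U(2) unfolding Q_def[abs_def]
      by (intro borel_measurable_divide borel_measurable_diff borel_measurable_integrable) auto
    have "(\<lambda>i. LINT t|M. Q (X i) t) \<longlonglongrightarrow> (LINT t|M. f' t)"
    proof (rule integral_dominated_convergence[OF _ Q_meas w])
      show "f' \<in> borel_measurable M"
        using Q_meas lim by (rule borel_measurable_LIMSEQ_metric)
      show "AE t in M. norm (Q (X i) t) \<le> w t" for i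
        using lip
      proof eventually_elim
        case (elim t)
        then have "norm (f (X i) t - f z t) \<le> w t * norm (X i - z)"
          using X(1) U(2) by (auto dest!: lipschitz_onD[where x = "X i" and y = z] simp: dist_norm)
        then show ?case using X(1) by (simp add: Q_def norm_divide divide_le_eq)
      qed
      show "AE t in M. (\<lambda>i. Q (X i) t) \<longlonglongrightarrow> f' t"
        using AE_space by eventually_elim (rule lim)
    qed
    then show "(\<lambda>i. ((LINT t|M. f (X i) t) - (LINT t|M. f z t)) / (X i - z)) \<longlonglongrightarrow> (LINT t|M. f' t)"
      using int X U by (simp add: Q_def)
  qed
  then show ?thesis using at_within_open[OF U(2,1)] by (simp add: has_field_derivative_iff)
qed

lemma has_field_derivative_integral_holomorphic:
  fixes f :: "complex \<Rightarrow> 'a \<Rightarrow> complex"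
  assumes S: "open S" and z: "z \<in> S" and w: "integrable M w"
    and meas: "\<And>z. z \<in> S \<Longrightarrow> f z \<in> borel_measurable M"
    and hol: "\<And>t. t \<in> space M \<Longrightarrow> (\<lambda>z. f z t) holomorphic_on S"
    and bound: "AE t in M. \<forall>z\<in>S. cmod (f z t) \<le> w t"
  shows "((\<lambda>z. LINT t|M. f z t) has_field_derivative (LINT t|M. deriv (\<lambda>z. f z t) z)) (at z)"
proof -
  obtain s where s: "s > 0" "cball z s \<subseteq> S" using S z open_contains_cball by blast
  define r where "r = s / 2"
  have r: "r > 0" "cball z (2 * r) \<subseteq> S" using s by (simp_all add: r_def)
  have cball: "cball y r \<subseteq> S" if "y \<in> ball z r" for y
  proof -
    have "cball y r \<subseteq> cball z (2 * r)" using that by (simp add: cball_subset_cball_iff dist_commute)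
    then show ?thesis using r by blast
  qed
  have int: "integrable M (f y)" if "y \<in> S" for y
  proof (rule Bochner_Integration.integrable_bound[OF w meas[OF that]])
    show "AE t in M. norm (f y t) \<le> norm (w t)"
      using bound by eventually_elim (use that in \<open>auto intro: order_trans[OF _ abs_ge_self]\<close>)
  qed
  show ?thesis
  proof (rule has_field_derivative_integral_lipschitz)
    show "((\<lambda>y. f y t) has_field_derivative deriv (\<lambda>z. f z t) z) (at z)" if "t \<in> space M" for t
      using holomorphic_derivI[OF hol[OF that] S z] .
    show "AE t in M. (w t / r)-lipschitz_on (ball z r) (\<lambda>z. f z t)"
      using bound AE_space
    proof eventually_elim
      case (elim t)
      have "w t \<ge> 0" using elim(1) z by (meson norm_ge_zero order_trans)
      then show ?case
        using elim r(1) cball by (intro bounded_holomorphic_lipschitz_on[OF S hol]) auto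
    qed
    show "integrable M (f y)" if "y \<in> ball z r" for y
      using cball[OF that] r(1) by (intro int) (auto simp: subset_iff)
  qed (use w r(1) in auto)
qed

section \<open>Polynomial approximation on the closed disc\<close>

lemma uniform_limit_dilation:
  fixes F :: "'a::euclidean_space \<Rightarrow> 'b::metric_space"
  assumes "continuous_on (cball 0 1) F"
  shows "uniform_limit (cball 0 1) (\<lambda>r w. F (r *\<^sub>R w)) F (at_left 1)"
proof (rule uniform_limitI)
  fix e :: real assume "e > 0"
  have "uniformly_continuous_on (cball 0 1) F"
    using assms by (intro compact_uniformly_continuous) auto
  then obtain d where d: "d > 0"
    "\<And>w v. w \<in> cball 0 1 \<Longrightarrow> v \<in> cball 0 1 \<Longrightarrow> dist v w < d \<Longrightarrow> dist (F v) (F w) < e"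
    using \<open>e > 0\<close> by (rule uniformly_continuous_onE) (rule that)
  have "\<forall>\<^sub>F r in at_left 1. r \<in> {max 0 (1 - d)<..<1}"
    using d by (intro eventually_at_left_real) auto
  then show "\<forall>\<^sub>F r in at_left 1. \<forall>w\<in>cball 0 1. dist (F (r *\<^sub>R w)) (F w) < e"
  proof (eventually_elim, intro ballI)
    fix r and w :: 'a assume r: "r \<in> {max 0 (1 - d)<..<1}" and w: "w \<in> cball 0 1"
    have "r * norm w \<le> 1" using r w by (simp add: mult_le_one)
    moreover have "dist (r *\<^sub>R w) w = (1 - r) * norm w"
    proof -
      have "r *\<^sub>R w - w = - ((1 - r) *\<^sub>R w)" by (simp add: algebra_simps)
      then show ?thesis using r by (simp add: dist_norm)
    qed
    moreover have "(1 - r) * norm w \<le> 1 - r" using r w by (intro mult_left_le) auto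
    moreover have "1 - r < d" "norm (r *\<^sub>R w) = r * norm w" using r by auto
    ultimately have "norm (r *\<^sub>R w) \<le> 1" "dist (r *\<^sub>R w) w < d" by linarith+
    then show "dist (F (r *\<^sub>R w)) (F w) < e" using w by (intro d) auto
  qed
qed

lemma holomorphic_poly_approx_cball:
  assumes hol: "F holomorphic_on ball 0 R" and r: "0 \<le> r" "r < R" and e: "e > 0"
  obtains P where "\<And>w. w \<in> cball 0 r \<Longrightarrow> cmod (F w - poly P w) < e"
proof -
  define a where "a n = (deriv ^^ n) F 0 / fact n" for n
  have series: "(\<lambda>n. a n * w ^ n) sums F w" if "w \<in> ball 0 R" for w
    using holomorphic_power_series[OF hol that] by (simp add: a_def)
  define s where "s = (r + R) / 2"
  have "complex_of_real s \<in> ball 0 R" using r by (simp add: s_def del: of_real_add of_real_divide)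
  then have "ereal (cmod (of_real s)) \<le> conv_radius a"
    by (intro conv_radius_geI sums_summable[OF series])
  moreover have "ereal r < ereal (cmod (of_real s))"
    using r by (simp add: s_def del: of_real_add of_real_divide)
  ultimately have "ereal r < conv_radius a" by (rule less_le_trans[rotated])
  from powser_uniform_limit[OF this, of 0]
  have "uniform_limit (cball 0 r) (\<lambda>n w. \<Sum>i<n. a i * w ^ i) (\<lambda>w. \<Sum>i. a i * w ^ i) sequentially"
    by simp
  from uniform_limitD[OF this e] obtain n
    where n: "\<And>w. w \<in> cball 0 r \<Longrightarrow> dist (\<Sum>i<n. a i * w ^ i) (\<Sum>i. a i * w ^ i) < e"
    unfolding eventually_sequentially by blast
  show ?thesis
  proof (rule that[of "\<Sum>i<n. monom (a i) i"])
    fix w :: complex assume w: "w \<in> cball 0 r"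
    then have "(\<Sum>i. a i * w ^ i) = F w" using series[of w] r by (simp add: sums_iff)
    then show "cmod (F w - poly (\<Sum>i<n. monom (a i) i) w) < e"
      using n[OF w] by (simp add: poly_sum poly_monom dist_norm norm_minus_commute)
  qed
qed

lemma disc_algebra_poly_approx:
  assumes cont: "continuous_on (cball 0 1) F" and hol: "F holomorphic_on ball 0 1" and e: "e > 0"
  obtains P where "\<And>w. w \<in> cball 0 1 \<Longrightarrow> cmod (F w - poly P w) < e"
proof -
  have "\<forall>\<^sub>F r in at_left (1::real). r \<in> {0<..<1}"
    by (rule eventually_at_left_real) simp
  moreover have "\<forall>\<^sub>F r in at_left 1. \<forall>w\<in>cball 0 1. dist (F (r *\<^sub>R w)) (F w) < e / 2"
    using uniform_limitD[OF uniform_limit_dilation[OF cont], of "e / 2"] e by simp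
  ultimately have
    "\<forall>\<^sub>F r in at_left (1::real). r \<in> {0<..<1}
        \<and> (\<forall>w\<in>cball 0 1. dist (F (r *\<^sub>R w)) (F w) < e / 2)"
    by (rule eventually_conj)
  then obtain r where r: "r \<in> {0<..<1}" "\<And>w. w \<in> cball 0 1 \<Longrightarrow> dist (F (r *\<^sub>R w)) (F w) < e / 2"
    by (auto dest: eventually_happens)
  obtain P where P: "\<And>w. w \<in> cball 0 r \<Longrightarrow> cmod (F w - poly P w) < e / 2"
    using holomorphic_poly_approx_cball[OF hol, of r "e / 2"] r e by auto
  show ?thesis
  proof (rule that[of "pcompose P [:0, of_real r:]"])
    fix w :: complex assume w: "w \<in> cball 0 1"
    then have "r *\<^sub>R w \<in> cball 0 r" using r(1) by (simp add: mult_left_le)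
    then have "dist (poly P (r *\<^sub>R w)) (F (r *\<^sub>R w)) < e / 2"
      using P by (simp add: dist_norm norm_minus_commute)
    then have "dist (F w) (poly P (r *\<^sub>R w)) < e"
      using r(2)[OF w] by (metis dist_commute dist_triangle_half_l)
    then show "cmod (F w - poly (pcompose P [:0, of_real r:]) w) < e"
      by (simp add: poly_pcompose dist_norm scaleR_conv_of_real mult.commute)
  qed
qed

section \<open>The norms\<close>

lemma open_Cplus: "open Cplus"
  unfolding Cplus_def by (rule open_halfspace_Re_gt)

lemma Cplus_subset_Cplus_cl: "Cplus \<subseteq> Cplus_cl"
  by (auto simp: Cplus_def Cplus_cl_def)

lemma Cplus_add_of_real: "z \<in> Cplus \<Longrightarrow> a \<ge> 0 \<Longrightarrow> z + of_real a \<in> Cplus"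
  by (simp add: Cplus_def)

lemma sup_norm_le_iff: "sup_norm f \<le> B \<longleftrightarrow> (\<forall>z\<in>Cplus. ennreal (cmod (f z)) \<le> B)"
  by (simp add: sup_norm_def SUP_le_iff)

lemma norm_le_sup_norm: "z \<in> Cplus \<Longrightarrow> ennreal (cmod (f z)) \<le> sup_norm f"
  by (auto simp: sup_norm_def intro: SUP_upper)

lemma sup_norm_cong: "(\<And>z. z \<in> Cplus \<Longrightarrow> f z = g z) \<Longrightarrow> sup_norm f = sup_norm g"
  by (auto simp: sup_norm_def intro!: SUP_cong)

lemma sup_norm_triangle: "sup_norm (\<lambda>z. f z + g z) \<le> sup_norm f + sup_norm g"
  unfolding sup_norm_le_iff
proof
  fix z assume "z \<in> Cplus"
  have "ennreal (cmod (f z + g z)) \<le> ennreal (cmod (f z)) + ennreal (cmod (g z))"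
    by (simp add: norm_triangle_ineq flip: ennreal_plus)
  also have "\<dots> \<le> sup_norm f + sup_norm g"
    using \<open>z \<in> Cplus\<close> by (intro add_mono norm_le_sup_norm)
  finally show "ennreal (cmod (f z + g z)) \<le> sup_norm f + sup_norm g" .
qed

lemma norm_limit_le_sup_norm:
  assumes "((\<lambda>x. f (complex_of_real x)) \<longlongrightarrow> c) at_top"
  shows "ennreal (cmod c) \<le> sup_norm f"
proof (rule tendsto_upperbound)
  show "((\<lambda>x. ennreal (cmod (f (complex_of_real x)))) \<longlongrightarrow> ennreal (cmod c)) at_top"
    by (intro tendsto_intros assms)
  show "\<forall>\<^sub>F x in at_top. ennreal (cmod (f (complex_of_real x))) \<le> sup_norm f"
    using eventually_gt_at_top[of 0] by eventually_elim
      (auto intro!: norm_le_sup_norm simp: Cplus_def)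
qed simp

definition deriv_vert_sup :: "(complex \<Rightarrow> complex) \<Rightarrow> real \<Rightarrow> ennreal" where
  "deriv_vert_sup f \<alpha> = indicator {0<..} \<alpha> * (SUP \<beta>::real. ennreal (cmod (deriv f (Complex \<alpha> \<beta>))))"

lemma B0_norm_eq: "B0_norm f = (\<integral>\<^sup>+ \<alpha>. deriv_vert_sup f \<alpha> \<partial>lborel)"
  by (simp add: B0_norm_def deriv_vert_sup_def)

lemma deriv_vert_sup_le_iff:
  "deriv_vert_sup f \<alpha> \<le> B \<longleftrightarrow> (\<forall>z\<in>Cplus. Re z = \<alpha> \<longrightarrow> ennreal (cmod (deriv f z)) \<le> B)"
proof (cases "\<alpha> > 0")
  case True
  then have "deriv_vert_sup f \<alpha> \<le> B \<longleftrightarrow> (\<forall>\<beta>. ennreal (cmod (deriv f (Complex \<alpha> \<beta>))) \<le> B)"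
    by (simp add: deriv_vert_sup_def SUP_le_iff)
  also have "\<dots> \<longleftrightarrow> (\<forall>z\<in>Cplus. Re z = \<alpha> \<longrightarrow> ennreal (cmod (deriv f z)) \<le> B)"
    using True
    by (metis (no_types, lifting) Cplus_def complex.exhaust_sel complex.sel(1) mem_Collect_eq)
  finally show ?thesis .
qed (simp add: deriv_vert_sup_def Cplus_def)

lemma norm_deriv_le_deriv_vert_sup:
  "z \<in> Cplus \<Longrightarrow> ennreal (cmod (deriv f z)) \<le> deriv_vert_sup f (Re z)"
  using deriv_vert_sup_le_iff by blast

lemma deriv_vert_sup_cong:
  assumes "\<And>z. z \<in> Cplus \<Longrightarrow> f z = g z"
  shows "deriv_vert_sup f \<alpha> = deriv_vert_sup g \<alpha>"
proof -
  have "deriv f z = deriv g z" if "z \<in> Cplus" for z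
    using that assms open_Cplus
    by (intro deriv_cong_ev eventually_nhds_in_open[THEN eventually_mono]) auto
  then show ?thesis
    by (auto simp: deriv_vert_sup_def indicator_def Cplus_def)
qed

lemma B_norm_cong: "(\<And>z. z \<in> Cplus \<Longrightarrow> f z = g z) \<Longrightarrow> B_norm f = B_norm g"
  using sup_norm_cong[of f g] deriv_vert_sup_cong[of f g] by (simp add: B_norm_def B0_norm_eq)

text \<open>Strict superlevel sets of \<open>deriv_vert_sup f\<close> are projections of open sets.\<close>

lemma deriv_vert_sup_measurable [measurable]:
  assumes "f holomorphic_on Cplus"
  shows "deriv_vert_sup f \<in> borel_measurable borel"
proof (rule borel_measurableI_greater)
  fix a :: ennreal
  let ?U = "{z \<in> Cplus. a < ennreal (cmod (deriv f z))}"
  have "continuous_on Cplus (\<lambda>z. ennreal (cmod (deriv f z)))"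
    by (intro continuous_on_ennreal continuous_on_norm holomorphic_on_imp_continuous_on
        holomorphic_deriv assms open_Cplus)
  then have "open (Cplus \<inter> (\<lambda>z. ennreal (cmod (deriv f z))) -` {a<..})"
    by (rule continuous_open_preimage[OF _ open_Cplus open_greaterThan])
  also have "Cplus \<inter> (\<lambda>z. ennreal (cmod (deriv f z))) -` {a<..} = ?U" by auto
  finally have "open (Re ` ?U)"
    using bounded_linear.linear[OF bounded_linear_Re] surjI[of Re complex_of_real]
    by (intro open_surjective_linear_image) auto
  moreover have "a < deriv_vert_sup f \<alpha> \<longleftrightarrow> \<alpha> \<in> Re ` ?U" for \<alpha>
    unfolding not_le[symmetric] deriv_vert_sup_le_iff by blast
  then have "{\<alpha> \<in> space borel. a < deriv_vert_sup f \<alpha>} = Re ` ?U" by auto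
  ultimately show "{\<alpha> \<in> space borel. a < deriv_vert_sup f \<alpha>} \<in> sets borel" by simp
qed

lemma deriv_vert_sup_triangle:
  assumes "f holomorphic_on Cplus" "g holomorphic_on Cplus"
  shows "deriv_vert_sup (\<lambda>z. f z + g z) \<alpha> \<le> deriv_vert_sup f \<alpha> + deriv_vert_sup g \<alpha>"
  unfolding deriv_vert_sup_le_iff
proof (intro ballI impI)
  fix z assume z: "z \<in> Cplus" "Re z = \<alpha>"
  have "deriv (\<lambda>z. f z + g z) z = deriv f z + deriv g z"
    using assms z open_Cplus by (intro deriv_add holomorphic_on_imp_differentiable_at)
  then have
    "ennreal (cmod (deriv (\<lambda>z. f z + g z) z))
        \<le> ennreal (cmod (deriv f z)) + ennreal (cmod (deriv g z))"
    by (simp add: norm_triangle_ineq flip: ennreal_plus)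
  also have "\<dots> \<le> deriv_vert_sup f \<alpha> + deriv_vert_sup g \<alpha>"
    unfolding z(2)[symmetric] by (intro add_mono norm_deriv_le_deriv_vert_sup z)
  finally show "ennreal (cmod (deriv (\<lambda>z. f z + g z) z)) \<le> \<dots>" .
qed

lemma B_norm_triangle:
  assumes "f holomorphic_on Cplus" "g holomorphic_on Cplus"
  shows "B_norm (\<lambda>z. f z + g z) \<le> B_norm f + B_norm g"
proof -
  have "B0_norm (\<lambda>z. f z + g z) \<le> (\<integral>\<^sup>+ \<alpha>. deriv_vert_sup f \<alpha> + deriv_vert_sup g \<alpha> \<partial>lborel)"
    unfolding B0_norm_eq by (intro nn_integral_mono deriv_vert_sup_triangle assms)
  also have "\<dots> = B0_norm f + B0_norm g"
    unfolding B0_norm_eq using assms by (intro nn_integral_add) measurable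
  finally have "B_norm (\<lambda>z. f z + g z) \<le> (sup_norm f + sup_norm g) + (B0_norm f + B0_norm g)"
    unfolding B_norm_def by (intro add_mono sup_norm_triangle)
  then show ?thesis by (simp add: B_norm_def ac_simps)
qed

lemma sup_norm_le_B_norm: "sup_norm f \<le> B_norm f"
  by (simp add: B_norm_def)

lemma B_norm_const: "B_norm (\<lambda>z. c) = ennreal (cmod c)"
proof -
  have "Cplus \<noteq> {}" by (auto simp: Cplus_def intro: exI[of _ 1])
  then show ?thesis
    by (simp add: B_norm_def sup_norm_def B0_norm_def bot_ennreal flip: zero_ennreal_def)
qed

section \<open>Bounded holomorphic functions on the half-plane\<close>

lemma cball_subset_half_plane: "r < Re z - a \<Longrightarrow> cball z r \<subseteq> {w. a < Re w}"
proof
  fix w assume "r < Re z - a" "w \<in> cball z r"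
  then have "\<bar>Re (z - w)\<bar> < Re z - a"
    using abs_Re_le_cmod[of "z - w"] by (simp add: dist_norm)
  then show "w \<in> {w. a < Re w}" by simp
qed

context
  fixes f :: "complex \<Rightarrow> complex" and G :: real
  assumes hol: "f holomorphic_on Cplus" and bound: "\<And>z. z \<in> Cplus \<Longrightarrow> cmod (f z) \<le> G"
begin

lemma Cplus_bound_nonneg: "G \<ge> 0"
  using order_trans[OF norm_ge_zero bound[of 1]] by (simp add: Cplus_def)

lemma norm_deriv_Cplus_le:
  assumes "z \<in> Cplus"
  shows "cmod (deriv f z) \<le> 2 * G / Re z"
proof -
  have "cball z (Re z / 2) \<subseteq> Cplus"
    using assms cball_subset_half_plane[of "Re z / 2" z 0] by (simp add: Cplus_def)
  then have "cmod (deriv f z) \<le> G / (Re z / 2)"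
    using assms bound by (intro norm_deriv_le_of_bounded[OF hol]) (auto simp: Cplus_def)
  then show ?thesis by (simp add: mult.commute)
qed

lemma lipschitz_on_half_plane:
  assumes "x > 0"
  shows "(2 * G / x)-lipschitz_on {z. x \<le> Re z} f"
proof -
  have "(G / (x / 2))-lipschitz_on {z. x \<le> Re z} f"
  proof (rule bounded_holomorphic_lipschitz_on[OF open_Cplus hol bound Cplus_bound_nonneg
    convex_halfspace_Re_ge])
    show "cball z (x / 2) \<subseteq> Cplus" if "z \<in> {z. x \<le> Re z}" for z
      using that assms cball_subset_half_plane[of "x / 2" z 0] by (simp add: Cplus_def)
  qed (use assms in auto)
  then show ?thesis by (simp add: mult.commute)
qed

lemma deriv_lipschitz_on_half_plane:
  assumes "x > 0"
  shows "(16 * G / x\<^sup>2)-lipschitz_on {z. x \<le> Re z} (deriv f)"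
proof -
  have "((4 * G / x) / (x / 4))-lipschitz_on {z. x \<le> Re z} (deriv f)"
  proof (rule bounded_holomorphic_lipschitz_on[where S = "{z. x / 2 < Re z}"])
    show "deriv f holomorphic_on {z. x / 2 < Re z}"
      using hol open_Cplus assms
      by (intro holomorphic_on_subset[OF holomorphic_deriv]) (auto simp: Cplus_def)
    show "cmod (deriv f z) \<le> 4 * G / x" if "z \<in> {z. x / 2 < Re z}" for z
    proof -
      have "cmod (deriv f z) \<le> 2 * G / Re z"
        using that assms by (intro norm_deriv_Cplus_le) (simp add: Cplus_def)
      also have "\<dots> \<le> 2 * G / (x / 2)"
        using that assms Cplus_bound_nonneg by (intro divide_left_mono) auto
      finally show ?thesis by simp
    qed
    show "cball z (x / 4) \<subseteq> {z. x / 2 < Re z}" if "z \<in> {z. x \<le> Re z}" for z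
      using that assms by (intro cball_subset_half_plane) simp
  qed (use assms Cplus_bound_nonneg in \<open>simp_all add: open_halfspace_Re_gt convex_halfspace_Re_ge
    del: less_divide_eq_numeral1 divide_less_eq_numeral1\<close>)
  then show ?thesis by (simp add: power2_eq_square mult.commute)
qed

end

lemma deriv_vert_sup_antimono:
  assumes hol: "f holomorphic_on Cplus" and bounded: "bounded (f ` Cplus)" and "0 < a" "a \<le> b"
  shows "deriv_vert_sup f b \<le> deriv_vert_sup f a"
proof -
  obtain G where G: "\<And>z. z \<in> Cplus \<Longrightarrow> cmod (f z) \<le> G"
    using bounded unfolding bounded_iff by blast
  have deriv_le: "cmod (deriv f z) \<le> 2 * G / a" if "a \<le> Re z" for z
  proof -
    have "cmod (deriv f z) \<le> 2 * G / Re z"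
      using that \<open>0 < a\<close> by (intro norm_deriv_Cplus_le hol G) (simp_all add: Cplus_def)
    also have "\<dots> \<le> 2 * G / a"
      using that \<open>0 < a\<close> Cplus_bound_nonneg[OF hol G] by (intro divide_left_mono) auto
    finally show ?thesis .
  qed
  then have "deriv_vert_sup f a \<le> ennreal (2 * G / a)"
    by (auto simp: deriv_vert_sup_le_iff intro: ennreal_leI)
  then obtain B where B: "deriv_vert_sup f a = ennreal B" "B \<ge> 0"
    by (cases "deriv_vert_sup f a") (auto simp: top_unique)
  have "cmod (deriv f z) \<le> B" if "Re z = b" for z
  proof (rule half_plane_maximum_modulus[where f = "deriv f" and a = a])
    have hol': "deriv f holomorphic_on Cplus" using hol open_Cplus by (rule holomorphic_deriv)
    show "deriv f holomorphic_on {z. a < Re z}"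
      using \<open>0 < a\<close> by (intro holomorphic_on_subset[OF hol']) (auto simp: Cplus_def)
    show "continuous_on {z. a \<le> Re z} (deriv f)"
      using \<open>0 < a\<close>
      by (intro continuous_on_subset[OF holomorphic_on_imp_continuous_on[OF hol']])
        (auto simp: Cplus_def)
    show "bounded (deriv f ` {z. a \<le> Re z})" using deriv_le by (auto simp: bounded_iff)
    show "cmod (deriv f z) \<le> B" if "Re z = a" for z
      using norm_deriv_le_deriv_vert_sup[of z f] that B \<open>0 < a\<close> by (simp add: Cplus_def)
  qed (use that \<open>a \<le> b\<close> in simp)
  then show ?thesis using B by (auto simp: deriv_vert_sup_le_iff intro: ennreal_leI)
qed

section \<open>Limits at infinity in the space B\<close>

definition deriv_tail :: "(complex \<Rightarrow> complex) \<Rightarrow> real \<Rightarrow> ennreal" where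
  "deriv_tail f x = (\<integral>\<^sup>+ \<alpha>. deriv_vert_sup f \<alpha> * indicator {x..} \<alpha> \<partial>lborel)"

lemma deriv_tail_le_B0_norm: "deriv_tail f x \<le> B0_norm f"
  unfolding B0_norm_eq deriv_tail_def by (intro nn_integral_mono) (auto simp: indicator_def)

lemma B_spaceD:
  assumes "f \<in> B_space"
  shows "f holomorphic_on Cplus" "(\<integral>\<^sup>+ \<alpha>. deriv_vert_sup f \<alpha> \<partial>lborel) < \<infinity>"
    "deriv_vert_sup f \<in> borel_measurable lborel"
  using assms deriv_vert_sup_measurable by (auto simp: B_space_def B0_norm_eq)

lemma deriv_tail_tendsto_0:
  assumes "f \<in> B_space"
  shows "(deriv_tail f \<longlongrightarrow> 0) at_top"
proof (rule tendsto_at_topI_sequentially)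
  fix X :: "nat \<Rightarrow> real" assume "filterlim X at_top sequentially"
  then have "\<forall>\<^sub>F n in sequentially. \<alpha> \<notin> {X n..}" for \<alpha>
    by (simp add: filterlim_at_top_dense not_le)
  then show "(\<lambda>n. deriv_tail f (X n)) \<longlonglongrightarrow> 0"
    unfolding deriv_tail_def using assms by (intro nn_integral_indicator_tendsto_0 B_spaceD) auto
qed

lemma horizontal_diff_le:
  assumes f: "f holomorphic_on Cplus" and z: "z \<in> Cplus" and s: "s \<ge> 0"
  shows "ennreal (cmod (f (z + of_real s) - f z))
    \<le> (\<integral>\<^sup>+ \<alpha>. deriv_vert_sup f \<alpha> * indicator {Re z..Re z + s} \<alpha> \<partial>lborel)"
proof -
  define \<gamma> where "\<gamma> \<alpha> = of_real \<alpha> + \<i> * Im z" for \<alpha> :: real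
  let ?I = "{Re z..Re z + s}"
  have \<gamma>_Cplus: "\<gamma> \<alpha> \<in> Cplus" if "\<alpha> \<in> ?I" for \<alpha> using that z by (simp add: \<gamma>_def Cplus_def)
  have ends: "\<gamma> (Re z) = z" "\<gamma> (Re z + s) = z + of_real s" by (simp_all add: \<gamma>_def complex_eq_iff)
  have "((\<lambda>\<alpha>. f (\<gamma> \<alpha>)) has_vector_derivative deriv f (\<gamma> \<alpha>)) (at \<alpha> within ?I)" if "\<alpha> \<in> ?I" for \<alpha>
  proof -
    have "(\<gamma> has_vector_derivative 1) (at \<alpha> within ?I)"
      unfolding \<gamma>_def[abs_def] by (auto intro!: derivative_eq_intros)
    then show ?thesis
      using holomorphic_derivI[OF f open_Cplus \<gamma>_Cplus[OF that]]
        field_vector_diff_chain_within[of \<gamma> 1 \<alpha> ?I f "deriv f (\<gamma> \<alpha>)"]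
      by (simp add: o_def has_field_derivative_at_within)
  qed
  moreover have "continuous_on ?I (\<lambda>\<alpha>. deriv f (\<gamma> \<alpha>))"
  proof (rule continuous_on_compose2[of Cplus "deriv f"])
    show "continuous_on Cplus (deriv f)"
      using f open_Cplus by (intro holomorphic_on_imp_continuous_on holomorphic_deriv)
    show "continuous_on ?I \<gamma>" unfolding \<gamma>_def by (intro continuous_intros)
  qed (use \<gamma>_Cplus in auto)
  ultimately have FTC: "has_bochner_integral lborel (\<lambda>\<alpha>. indicator ?I \<alpha> *\<^sub>R deriv f (\<gamma> \<alpha>))
      (f (z + of_real s) - f z)"
    using has_bochner_integral_FTC_Icc[of "Re z" "Re z + s" "\<lambda>\<alpha>. f (\<gamma> \<alpha>)"] s by (simp add: ends)
  have "ennreal (cmod (f (z + of_real s) - f z))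
     \<le> (\<integral>\<^sup>+ \<alpha>. ennreal (cmod (indicator ?I \<alpha> *\<^sub>R deriv f (\<gamma> \<alpha>))) \<partial>lborel)"
    using integral_norm_bound_ennreal[OF integrable.intros[OF FTC]]
    by (simp only: has_bochner_integral_integral_eq[OF FTC])
  also have "\<dots> \<le> (\<integral>\<^sup>+ \<alpha>. deriv_vert_sup f \<alpha> * indicator ?I \<alpha> \<partial>lborel)"
  proof (rule nn_integral_mono)
    fix \<alpha>
    show "ennreal (cmod (indicator ?I \<alpha> *\<^sub>R deriv f (\<gamma> \<alpha>))) \<le> deriv_vert_sup f \<alpha> * indicator ?I \<alpha>"
      using norm_deriv_le_deriv_vert_sup[OF \<gamma>_Cplus] by (auto simp: indicator_def \<gamma>_def)
  qed
  finally show ?thesis .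
qed

lemma horizontal_diff_le_deriv_tail:
  assumes f: "f holomorphic_on Cplus" and z: "z \<in> Cplus" "Re z \<le> x"
  shows "ennreal (cmod (f (Complex x (Im z)) - f z)) \<le> deriv_tail f (Re z)"
proof -
  have "Complex x (Im z) = z + of_real (x - Re z)" by (simp add: complex_eq_iff)
  then have "ennreal (cmod (f (Complex x (Im z)) - f z))
      \<le> (\<integral>\<^sup>+ \<alpha>. deriv_vert_sup f \<alpha> * indicator {Re z..Re z + (x - Re z)} \<alpha> \<partial>lborel)"
    using horizontal_diff_le[OF f z(1), of "x - Re z"] z(2) by simp
  also have "\<dots> \<le> deriv_tail f (Re z)"
    unfolding deriv_tail_def by (intro nn_integral_mono) (auto simp: indicator_def)
  finally show ?thesis .
qed

lemma vertical_diff_le: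
  assumes f: "f holomorphic_on Cplus" and x: "x > 0" and e: "deriv_vert_sup f x \<le> ennreal e" "e \<ge> 0"
  shows "cmod (f (Complex x b) - f (Complex x b')) \<le> e * \<bar>b - b'\<bar>"
proof -
  let ?S = "{w. Re w = x}"
  have sub: "?S \<subseteq> Cplus" using x by (auto simp: Cplus_def)
  have "cmod (f (Complex x b) - f (Complex x b')) \<le> e * cmod (Complex x b - Complex x b')"
  proof (rule field_differentiable_bound)
    show "convex ?S" by (auto simp: convex_def simp flip: distrib_right)
    show "(f has_field_derivative deriv f w) (at w within ?S)" if "w \<in> ?S" for w
      by (rule holomorphic_derivI[OF f open_Cplus]) (use that sub in auto)
    show "cmod (deriv f w) \<le> e" if "w \<in> ?S" for w
      using that sub e by (auto simp: deriv_vert_sup_le_iff)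
  qed auto
  also have "Complex x b - Complex x b' = \<i> * of_real (b - b')" by (simp add: complex_eq_iff)
  finally show ?thesis by (simp add: norm_mult del: of_real_diff)
qed

lemma deriv_vert_sup_small:
  assumes "f \<in> B_space" and e: "e > 0"
  shows "\<exists>x\<ge>a. deriv_vert_sup f x \<le> ennreal e"
proof (rule ccontr)
  assume "\<not> ?thesis"
  then have large: "ennreal e \<le> deriv_vert_sup f x" if "x \<ge> a" for x
    using that by (meson nle_le)
  obtain N where N: "B0_norm f = ennreal N" "N \<ge> 0"
    using assms by (cases "B0_norm f") (auto simp: B_space_def)
  let ?I = "{a..a + (N + 1) / e}"
  have "ennreal (N + 1) = (\<integral>\<^sup>+ \<alpha>. ennreal e * indicator ?I \<alpha> \<partial>lborel)"
    using e N by (simp add: nn_integral_cmult_indicator flip: ennreal_mult)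
  also have "\<dots> \<le> B0_norm f"
    unfolding B0_norm_eq using large by (intro nn_integral_mono) (auto simp: indicator_def)
  finally show False using N by simp
qed

text \<open>The derivative is small on a sequence of vertical lines, so \<open>f\<close> becomes constant along them;
  monotonicity of \<open>deriv_vert_sup\<close> is not yet available, as \<open>f\<close> is not yet known to be bounded.\<close>

lemma B_space_tendsto_along_verticals:
  assumes "f \<in> B_space"
  obtains x :: "nat \<Rightarrow> real" and c
  where "\<And>k. x k \<ge> real k" "\<And>b. (\<lambda>k. f (Complex (x k) b)) \<longlonglongrightarrow> c"
proof -
  have f: "f holomorphic_on Cplus" using assms by (rule B_spaceD)
  have "\<exists>x. x \<ge> real k + 1 \<and> deriv_vert_sup f x \<le> ennreal (1 / (real k + 1))" for k
    using deriv_vert_sup_small[OF assms] by simp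
  then obtain x
    where x: "\<And>k. x k \<ge> real k + 1" "\<And>k. deriv_vert_sup f (x k) \<le> ennreal (1 / (real k + 1))"
    by metis
  then have x_pos: "x k > 0" for k by (auto intro: less_le_trans[of 0 "real k + 1"])
  obtain N where N: "B0_norm f = ennreal N" "N \<ge> 0"
    using assms by (cases "B0_norm f") (auto simp: B_space_def)
  have "f (Complex (x k) 0) \<in> cball (f 1) N" for k
    using order_trans[OF horizontal_diff_le_deriv_tail[OF f, of 1 "x k"] deriv_tail_le_B0_norm]
      x(1)[of k] N
    by (simp add: Cplus_def dist_norm norm_minus_commute)
  then have "bounded (range (\<lambda>k. f (Complex (x k) 0)))"
    by (intro bounded_subset[OF bounded_cball]) auto
  then obtain c r where r: "strict_mono r" and c: "(\<lambda>k. f (Complex (x (r k)) 0)) \<longlonglongrightarrow> c"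
    using bounded_imp_convergent_subsequence[of "\<lambda>k. f (Complex (x k) 0)"] by (auto simp: o_def)
  show ?thesis
  proof (rule that)
    show "x (r k) \<ge> real k" for k using x(1)[of "r k"] seq_suble[OF r, of k] by linarith
    fix b
    have "(\<lambda>k. f (Complex (x (r k)) b) - f (Complex (x (r k)) 0)) \<longlonglongrightarrow> 0"
    proof (rule Lim_null_comparison)
      show "\<forall>\<^sub>F k in sequentially. cmod (f (Complex (x (r k)) b) - f (Complex (x (r k)) 0))
          \<le> 1 / (real (r k) + 1) * \<bar>b - 0\<bar>"
        by (intro always_eventually allI vertical_diff_le f x x_pos) simp
      have "(\<lambda>k. 1 / (real (r k) + 1)) \<longlonglongrightarrow> 0"
        using LIMSEQ_subseq_LIMSEQ[OF LIMSEQ_Suc[OF lim_1_over_n] r]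
        by (simp add: o_def add.commute)
      then show "(\<lambda>k. 1 / (real (r k) + 1) * \<bar>b - 0\<bar>) \<longlonglongrightarrow> 0" by (rule tendsto_mult_left_zero)
    qed
    from tendsto_add[OF this c] show "(\<lambda>k. f (Complex (x (r k)) b)) \<longlonglongrightarrow> c" by simp
  qed
qed

lemma B_space_limit_at_infinity:
  assumes "f \<in> B_space"
  obtains c where "\<And>z. z \<in> Cplus \<Longrightarrow> ennreal (cmod (f z - c)) \<le> deriv_tail f (Re z)"
proof -
  obtain x :: "nat \<Rightarrow> real" and c where x: "\<And>k. x k \<ge> real k" "\<And>b. (\<lambda>k. f (Complex (x k) b)) \<longlonglongrightarrow> c"
    by (rule B_space_tendsto_along_verticals[OF assms]) (rule that)
  show ?thesis
  proof (rule that)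
    fix z assume z: "z \<in> Cplus"
    have "(\<lambda>k. ennreal (cmod (f (Complex (x k) (Im z)) - f z))) \<longlonglongrightarrow> ennreal (cmod (c - f z))"
      by (intro tendsto_intros x)
    moreover have
      "\<forall>\<^sub>F k in sequentially. ennreal (cmod (f (Complex (x k) (Im z)) - f z)) \<le> deriv_tail f (Re z)"
      using eventually_ge_at_top[of "nat \<lceil>Re z\<rceil>"]
    proof eventually_elim
      case (elim k)
      then have "Re z \<le> x k" using x(1)[of k] by linarith
      then show ?case using assms z by (intro horizontal_diff_le_deriv_tail B_spaceD)
    qed
    ultimately show "ennreal (cmod (f z - c)) \<le> deriv_tail f (Re z)"
      by (subst norm_minus_commute) (rule tendsto_upperbound, auto)
  qed
qed

lemma B_space_tendsto_at_top:
  assumes "f \<in> B_space" and c: "\<And>z. z \<in> Cplus \<Longrightarrow> ennreal (cmod (f z - c)) \<le> deriv_tail f (Re z)"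
  shows "((\<lambda>x. f (complex_of_real x)) \<longlongrightarrow> c) at_top"
proof -
  have "((\<lambda>x. ennreal (cmod (f (complex_of_real x) - c))) \<longlongrightarrow> 0) at_top"
  proof (rule ennreal_Lim_null_comparison[OF deriv_tail_tendsto_0[OF assms(1)]])
    show "\<forall>\<^sub>F x in at_top. ennreal (cmod (f (complex_of_real x) - c)) \<le> deriv_tail f x"
      using eventually_gt_at_top[of 0]
    proof eventually_elim
      case (elim x)
      then show ?case using c[of "of_real x"] by (simp add: Cplus_def)
    qed
  qed
  then have "((\<lambda>x. f (complex_of_real x) - c) \<longlongrightarrow> 0) at_top"
    using tendsto_ennrealD[of "\<lambda>x. cmod (f (complex_of_real x) - c)" 0 at_top]
    by (simp add: tendsto_norm_zero_iff)
  then show ?thesis by (rule Lim_null[THEN iffD2])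
qed

lemma B_space_bounded:
  assumes "f \<in> B_space"
  shows "bounded (f ` Cplus)"
proof -
  obtain c where c: "\<And>z. z \<in> Cplus \<Longrightarrow> ennreal (cmod (f z - c)) \<le> deriv_tail f (Re z)"
    using B_space_limit_at_infinity[OF assms] by blast
  obtain N where N: "B0_norm f = ennreal N" "N \<ge> 0"
    using assms by (cases "B0_norm f") (auto simp: B_space_def)
  have "f z \<in> cball c N" if "z \<in> Cplus" for z
    using order_trans[OF c[OF that] deriv_tail_le_B0_norm] N
    by (simp add: dist_norm norm_minus_commute)
  then show ?thesis by (intro bounded_subset[OF bounded_cball]) auto
qed

section \<open>Differences of shifts\<close>

definition shift_diff :: "real \<Rightarrow> real \<Rightarrow> (complex \<Rightarrow> complex) \<Rightarrow> complex \<Rightarrow> complex" where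
  "shift_diff a b f z = f (z + of_real a) - f (z + of_real b)"

lemma has_field_derivative_shift:
  assumes "f holomorphic_on Cplus" "a \<ge> 0" "z \<in> Cplus"
  shows "((\<lambda>z. f (z + of_real a)) has_field_derivative deriv f (z + of_real a)) (at z)"
  using holomorphic_derivI[OF assms(1) open_Cplus Cplus_add_of_real[OF assms(3,2)], where T = UNIV]
  by (simp add: DERIV_shift)

lemma holomorphic_on_shift:
  assumes "f holomorphic_on Cplus" "a \<ge> 0"
  shows "(\<lambda>z. f (z + of_real a)) holomorphic_on Cplus"
  using has_field_derivative_shift[OF assms] open_Cplus by (auto simp: holomorphic_on_open)

lemma holomorphic_on_shift_diff:
  assumes "f holomorphic_on Cplus" "a \<ge> 0" "b \<ge> 0"
  shows "shift_diff a b f holomorphic_on Cplus"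
  unfolding shift_diff_def[abs_def] using assms by (intro holomorphic_on_diff holomorphic_on_shift)

lemma deriv_shift_diff:
  assumes "f holomorphic_on Cplus" "a \<ge> 0" "b \<ge> 0" "z \<in> Cplus"
  shows "deriv (shift_diff a b f) z = shift_diff a b (deriv f) z"
  unfolding shift_diff_def[abs_def] using assms
  by (intro DERIV_imp_deriv DERIV_diff has_field_derivative_shift)

lemma deriv_vert_sup_shift_diff_le_sum:
  assumes f: "f holomorphic_on Cplus" and ab: "a \<ge> 0" "b \<ge> 0"
  shows "deriv_vert_sup (shift_diff a b f) \<alpha> \<le> deriv_vert_sup f (\<alpha> + a) + deriv_vert_sup f (\<alpha> + b)"
  unfolding deriv_vert_sup_le_iff
proof (intro ballI impI)
  fix z assume z: "z \<in> Cplus" "Re z = \<alpha>"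
  have "ennreal (cmod (deriv (shift_diff a b f) z))
      \<le> ennreal (cmod (deriv f (z + of_real a))) + ennreal (cmod (deriv f (z + of_real b)))"
    unfolding deriv_shift_diff[OF f ab z(1)] shift_diff_def
    by (simp add: norm_triangle_ineq4 flip: ennreal_plus)
  also have "\<dots> \<le> deriv_vert_sup f (\<alpha> + a) + deriv_vert_sup f (\<alpha> + b)"
    using norm_deriv_le_deriv_vert_sup[of "z + of_real a" f]
      norm_deriv_le_deriv_vert_sup[of "z + of_real b" f]
      z ab by (intro add_mono) (simp_all add: Cplus_def)
  finally show "ennreal (cmod (deriv (shift_diff a b f) z)) \<le> \<dots>" .
qed

lemma deriv_vert_sup_shift_diff_le:
  assumes f: "f holomorphic_on Cplus" and G: "\<And>z. z \<in> Cplus \<Longrightarrow> cmod (f z) \<le> G"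
    and "0 \<le> a" "a \<le> b" "\<alpha> > 0"
  shows "deriv_vert_sup (shift_diff a b f) \<alpha> \<le> ennreal (16 * G * (b - a) / (\<alpha> + a)\<^sup>2)"
  unfolding deriv_vert_sup_le_iff
proof (intro ballI impI ennreal_leI)
  fix z assume z: "z \<in> Cplus" "Re z = \<alpha>"
  have "dist (deriv f (z + of_real a)) (deriv f (z + of_real b))
      \<le> 16 * G / (\<alpha> + a)\<^sup>2 * dist (z + of_real a) (z + of_real b)"
    using assms z by (intro lipschitz_onD[OF deriv_lipschitz_on_half_plane[OF f G]]) auto
  also have "dist (z + of_real a) (z + of_real b) = b - a"
    using \<open>a \<le> b\<close> by (simp add: dist_norm flip: of_real_diff)
  finally show "cmod (deriv (shift_diff a b f) z) \<le> 16 * G * (b - a) / (\<alpha> + a)\<^sup>2"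
    using assms z by (simp add: deriv_shift_diff shift_diff_def dist_norm)
qed

text \<open>Two cancelling shifts gain a second derivative, hence integrability at infinity; the first
  shift removes the singularity at 0.\<close>

lemma B0_norm_shift_diff_le:
  assumes f: "f holomorphic_on Cplus" and G: "\<And>z. z \<in> Cplus \<Longrightarrow> cmod (f z) \<le> G"
    and \<delta>: "0 < \<delta>" "\<delta> \<le> n"
  shows "B0_norm (shift_diff \<delta> n f) \<le> ennreal (16 * n / \<delta> * G)"
proof -
  have G_nonneg: "G \<ge> 0" by (rule Cplus_bound_nonneg[OF f G])
  have "deriv_vert_sup (shift_diff \<delta> n f) \<alpha>
      \<le> ennreal (16 * G * n) * (ennreal (1 / (\<alpha> + \<delta>)\<^sup>2) * indicator {0..} \<alpha>)" for \<alpha>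
  proof (cases "\<alpha> > 0")
    case True
    have "deriv_vert_sup (shift_diff \<delta> n f) \<alpha> \<le> ennreal (16 * G * (n - \<delta>) / (\<alpha> + \<delta>)\<^sup>2)"
      using True \<delta> by (intro deriv_vert_sup_shift_diff_le f G) auto
    also have "\<dots> \<le> ennreal (16 * G * n / (\<alpha> + \<delta>)\<^sup>2)"
      using G_nonneg \<delta> by (intro ennreal_leI divide_right_mono mult_left_mono) auto
    also have "\<dots> = ennreal (16 * G * n) * ennreal (1 / (\<alpha> + \<delta>)\<^sup>2)"
      using G_nonneg \<delta> by (subst ennreal_mult'[symmetric]) auto
    finally show ?thesis using True by simp
  qed (simp add: deriv_vert_sup_def)
  then have "B0_norm (shift_diff \<delta> n f)
      \<le> (\<integral>\<^sup>+ \<alpha>. ennreal (16 * G * n) * (ennreal (1 / (\<alpha> + \<delta>)\<^sup>2) * indicator {0..} \<alpha>) \<partial>lborel)"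
    unfolding B0_norm_eq by (intro nn_integral_mono)
  also have "\<dots> = ennreal (16 * G * n) * ennreal (1 / \<delta>)"
    using \<delta> by (simp add: nn_integral_cmult nn_integral_inverse_square)
  also have "\<dots> = ennreal (16 * n / \<delta> * G)"
    using G_nonneg \<delta> by (subst ennreal_mult'[symmetric]) (auto simp: mult_ac)
  finally show ?thesis .
qed

lemma sup_norm_shift_diff_le:
  assumes "0 \<le> a" "0 \<le> b"
  shows "sup_norm (shift_diff a b f) \<le> 2 * sup_norm f"
  unfolding sup_norm_le_iff
proof
  fix z assume "z \<in> Cplus"
  have "ennreal (cmod (shift_diff a b f z))
      \<le> ennreal (cmod (f (z + of_real a))) + ennreal (cmod (f (z + of_real b)))"
    unfolding shift_diff_def by (simp add: norm_triangle_ineq4 flip: ennreal_plus)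
  also have "\<dots> \<le> sup_norm f + sup_norm f"
    using assms \<open>z \<in> Cplus\<close> by (intro add_mono norm_le_sup_norm Cplus_add_of_real)
  finally show "ennreal (cmod (shift_diff a b f z)) \<le> 2 * sup_norm f" by (simp add: mult_2)
qed

lemma B_norm_shift_diff_le:
  assumes f: "f holomorphic_on Cplus" and \<delta>: "0 < \<delta>" "\<delta> \<le> n"
  shows "B_norm (shift_diff \<delta> n f) \<le> ennreal (2 + 16 * n / \<delta>) * sup_norm f"
proof (cases "sup_norm f")
  case (real G)
  have "cmod (f z) \<le> G" if "z \<in> Cplus" for z
    using norm_le_sup_norm[OF that, of f] real by simp
  then have "B_norm (shift_diff \<delta> n f) \<le> 2 * ennreal G + ennreal (16 * n / \<delta> * G)"
    unfolding B_norm_def using sup_norm_shift_diff_le[of \<delta> n f] \<delta> real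
    by (intro add_mono B0_norm_shift_diff_le f) auto
  also have "\<dots> = ennreal (2 + 16 * n / \<delta>) * ennreal G"
    using real \<delta> by (simp add: distrib_right flip: ennreal_mult' ennreal_numeral ennreal_plus)
  finally show ?thesis by (simp add: real)
next
  case top
  have "2 + 16 * n / \<delta> > 0" using \<delta> by (simp add: add_pos_nonneg)
  then show ?thesis using top by (simp add: ennreal_mult_top)
qed

lemma deriv_vert_sup_shift_diff_le_double:
  assumes f: "f holomorphic_on Cplus" "bounded (f ` Cplus)" and "b \<ge> 0"
  shows "deriv_vert_sup (shift_diff 0 b f) \<alpha> \<le> 2 * deriv_vert_sup f \<alpha>"
proof (cases "\<alpha> > 0")
  case True
  have "deriv_vert_sup (shift_diff 0 b f) \<alpha> \<le> deriv_vert_sup f (\<alpha> + 0) + deriv_vert_sup f (\<alpha> + b)"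
    using \<open>b \<ge> 0\<close> by (intro deriv_vert_sup_shift_diff_le_sum f) auto
  also have "\<dots> \<le> deriv_vert_sup f \<alpha> + deriv_vert_sup f \<alpha>"
    using True \<open>b \<ge> 0\<close> by (intro add_mono deriv_vert_sup_antimono f) auto
  finally show ?thesis by (simp only: mult_2)
qed (simp add: deriv_vert_sup_def)

lemma deriv_vert_sup_shift_diff_tendsto_0:
  assumes f: "f holomorphic_on Cplus" "bounded (f ` Cplus)" and \<delta>: "\<And>n. \<delta> n \<ge> 0" "\<delta> \<longlonglongrightarrow> 0"
  shows "(\<lambda>n. deriv_vert_sup (shift_diff 0 (\<delta> n) f) \<alpha>) \<longlonglongrightarrow> 0"
proof (cases "\<alpha> > 0")
  case True
  obtain G where G: "\<And>z. z \<in> Cplus \<Longrightarrow> cmod (f z) \<le> G"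
    using f(2) unfolding bounded_iff by blast
  have "(\<lambda>n. ennreal (16 * G * (\<delta> n - 0) / (\<alpha> + 0)\<^sup>2)) \<longlonglongrightarrow> ennreal (16 * G * (0 - 0) / (\<alpha> + 0)\<^sup>2)"
    by (intro tendsto_intros \<delta>) (use True in simp)
  then have "(\<lambda>n. ennreal (16 * G * (\<delta> n - 0) / (\<alpha> + 0)\<^sup>2)) \<longlonglongrightarrow> 0" by simp
  moreover have "deriv_vert_sup (shift_diff 0 (\<delta> n) f) \<alpha> \<le> ennreal (16 * G * (\<delta> n - 0) / (\<alpha> + 0)\<^sup>2)"
    for n
    using True \<delta>(1)[of n] by (intro deriv_vert_sup_shift_diff_le f G) auto
  ultimately show ?thesis by (rule ennreal_Lim_null_comparison[OF _ always_eventually[OF allI]])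
qed (simp add: deriv_vert_sup_def)

lemma B0_norm_shift_diff_tendsto_0:
  assumes g: "g \<in> B_space"
  shows "((\<lambda>\<delta>. B0_norm (shift_diff 0 \<delta> g)) \<longlongrightarrow> 0) (at_right 0)"
proof (rule tendsto_at_right_sequentially[where b = 1])
  fix \<delta> :: "nat \<Rightarrow> real" assume "\<And>n. 0 < \<delta> n" and \<delta>: "\<delta> \<longlonglongrightarrow> 0"
  then have nonneg: "\<delta> n \<ge> 0" for n by (simp add: less_imp_le)
  note hol = B_spaceD(1)[OF g]
  have "(\<lambda>n. B0_norm (shift_diff 0 (\<delta> n) g)) \<longlonglongrightarrow> (\<integral>\<^sup>+ \<alpha>. 0 \<partial>(lborel :: real measure))"
    unfolding B0_norm_eq
  proof (rule nn_integral_dominated_convergence[where w = "\<lambda>\<alpha>. 2 * deriv_vert_sup g \<alpha>"])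
    show "deriv_vert_sup (shift_diff 0 (\<delta> n) g) \<in> borel_measurable lborel" for n
      using deriv_vert_sup_measurable[OF holomorphic_on_shift_diff[OF hol order_refl nonneg]]
      by simp
    show "(\<lambda>\<alpha>. 2 * deriv_vert_sup g \<alpha>) \<in> borel_measurable lborel"
      "(\<integral>\<^sup>+ \<alpha>. 2 * deriv_vert_sup g \<alpha> \<partial>lborel) < \<infinity>"
      using B_spaceD[OF g] by (auto simp: nn_integral_cmult ennreal_mult_less_top)
    show "AE \<alpha> in lborel. deriv_vert_sup (shift_diff 0 (\<delta> n) g) \<alpha> \<le> 2 * deriv_vert_sup g \<alpha>" for n
      by (intro AE_I2 deriv_vert_sup_shift_diff_le_double hol B_space_bounded g nonneg)
    show "AE \<alpha> in lborel. (\<lambda>n. deriv_vert_sup (shift_diff 0 (\<delta> n) g) \<alpha>) \<longlonglongrightarrow> 0"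
      by (intro AE_I2 deriv_vert_sup_shift_diff_tendsto_0 hol B_space_bounded g nonneg \<delta>)
  qed auto
  then show "(\<lambda>n. B0_norm (shift_diff 0 (\<delta> n) g)) \<longlonglongrightarrow> 0" by simp
qed simp

lemma sup_norm_shift_diff_le_integral:
  assumes g: "g \<in> B_space" and "\<delta> \<ge> 0"
  shows "sup_norm (shift_diff 0 \<delta> g) \<le> (\<integral>\<^sup>+ \<alpha>. deriv_vert_sup g \<alpha> * indicator {0..\<delta>} \<alpha> \<partial>lborel)"
  unfolding sup_norm_le_iff
proof
  fix z assume z: "z \<in> Cplus"
  let ?v = "deriv_vert_sup g"
  have "ennreal (cmod (shift_diff 0 \<delta> g z)) \<le> (\<integral>\<^sup>+ \<alpha>. ?v \<alpha> * indicator {Re z..Re z + \<delta>} \<alpha> \<partial>lborel)"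
    using horizontal_diff_le[OF B_spaceD(1)[OF g] z \<open>\<delta> \<ge> 0\<close>]
    by (simp add: shift_diff_def norm_minus_commute)
  also have "\<dots> = (\<integral>\<^sup>+ \<alpha>. ?v (Re z + \<alpha>) * indicator {0..\<delta>} \<alpha> \<partial>lborel)"
    using nn_integral_real_affine[of "\<lambda>\<alpha>. ?v \<alpha> * indicator {Re z..Re z + \<delta>} \<alpha>" 1 "Re z"]
      B_spaceD(3)[OF g]
    by (simp add: indicator_def)
  also have "\<dots> \<le> (\<integral>\<^sup>+ \<alpha>. ?v \<alpha> * indicator {0..\<delta>} \<alpha> \<partial>lborel)"
  proof (rule nn_integral_mono_AE)
    show "AE \<alpha> in lborel. ?v (Re z + \<alpha>) * indicator {0..\<delta>} \<alpha> \<le> ?v \<alpha> * indicator {0..\<delta>} \<alpha>"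
      using AE_lborel_singleton[of 0]
    proof eventually_elim
      case (elim \<alpha>)
      show ?case
        using elim z deriv_vert_sup_antimono[OF B_spaceD(1)[OF g] B_space_bounded[OF g],
          of \<alpha> "Re z + \<alpha>"]
        by (auto simp: indicator_def Cplus_def)
    qed
  qed
  finally show "ennreal (cmod (shift_diff 0 \<delta> g z)) \<le> \<dots>" .
qed

lemma sup_norm_shift_diff_tendsto_0:
  assumes g: "g \<in> B_space"
  shows "((\<lambda>\<delta>. sup_norm (shift_diff 0 \<delta> g)) \<longlongrightarrow> 0) (at_right 0)"
proof (rule tendsto_at_right_sequentially[where b = 1])
  fix \<delta> :: "nat \<Rightarrow> real" assume \<delta>: "\<And>n. 0 < \<delta> n" "\<delta> \<longlonglongrightarrow> 0"
  have "(\<lambda>n. \<integral>\<^sup>+ \<alpha>. deriv_vert_sup g \<alpha> * indicator {0..\<delta> n} \<alpha> \<partial>lborel) \<longlonglongrightarrow> 0"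
  proof (rule nn_integral_indicator_tendsto_0[OF B_spaceD(3)[OF g] B_spaceD(2)[OF g]])
    fix \<alpha> assume "deriv_vert_sup g \<alpha> \<noteq> 0"
    then have "\<alpha> > 0" by (auto simp: deriv_vert_sup_def indicator_def split: if_splits)
    from order_tendstoD(2)[OF \<delta>(2) this] show "\<forall>\<^sub>F n in sequentially. \<alpha> \<notin> {0..\<delta> n}"
      by eventually_elim simp
  qed simp
  then show "(\<lambda>n. sup_norm (shift_diff 0 (\<delta> n) g)) \<longlonglongrightarrow> 0"
  proof (rule ennreal_Lim_null_comparison)
    show "\<forall>\<^sub>F n in sequentially. sup_norm (shift_diff 0 (\<delta> n) g)
        \<le> (\<integral>\<^sup>+ \<alpha>. deriv_vert_sup g \<alpha> * indicator {0..\<delta> n} \<alpha> \<partial>lborel)"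
      using \<delta>(1) by (intro always_eventually allI sup_norm_shift_diff_le_integral g less_imp_le)
  qed
qed simp

lemma B_norm_shift_diff_tendsto_0:
  assumes "g \<in> B_space"
  shows "((\<lambda>\<delta>. B_norm (shift_diff 0 \<delta> g)) \<longlongrightarrow> 0) (at_right 0)"
  unfolding B_norm_def
  using tendsto_add[OF sup_norm_shift_diff_tendsto_0 B0_norm_shift_diff_tendsto_0, OF assms assms]
  by simp

lemma B_norm_shift_minus_limit_le:
  assumes g: "g \<in> B_space" and c: "\<And>z. z \<in> Cplus \<Longrightarrow> ennreal (cmod (g z - c)) \<le> deriv_tail g (Re z)"
    and n: "n \<ge> 0"
  shows "B_norm (\<lambda>z. g (z + of_real n) - c) \<le> 2 * deriv_tail g n"
proof -
  have "sup_norm (\<lambda>z. g (z + of_real n) - c) \<le> deriv_tail g n"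
    unfolding sup_norm_le_iff
  proof
    fix z assume z: "z \<in> Cplus"
    have "ennreal (cmod (g (z + of_real n) - c)) \<le> deriv_tail g (Re (z + of_real n))"
      using z n by (intro c Cplus_add_of_real)
    also have "\<dots> \<le> deriv_tail g n"
      using z unfolding deriv_tail_def
      by (intro nn_integral_mono) (auto simp: indicator_def Cplus_def)
    finally show "ennreal (cmod (g (z + of_real n) - c)) \<le> deriv_tail g n" .
  qed
  moreover have "B0_norm (\<lambda>z. g (z + of_real n) - c) \<le> deriv_tail g n"
  proof -
    let ?v = "\<lambda>\<alpha>. deriv_vert_sup g \<alpha> * indicator {n..} \<alpha>"
    have "deriv_vert_sup (\<lambda>z. g (z + of_real n) - c) \<alpha> \<le> ?v (n + \<alpha>)" for \<alpha>
      unfolding deriv_vert_sup_le_iff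
    proof (intro ballI impI)
      fix z assume z: "z \<in> Cplus" "Re z = \<alpha>"
      have "deriv (\<lambda>z. g (z + of_real n) - c) z = deriv g (z + of_real n) - 0"
        using z n B_spaceD[OF g]
        by (intro DERIV_imp_deriv DERIV_diff has_field_derivative_shift) auto
      then show "ennreal (cmod (deriv (\<lambda>z. g (z + of_real n) - c) z)) \<le> ?v (n + \<alpha>)"
        using norm_deriv_le_deriv_vert_sup[OF Cplus_add_of_real[OF z(1) n], of g] z
        by (auto simp: indicator_def Cplus_def add.commute)
    qed
    then have "B0_norm (\<lambda>z. g (z + of_real n) - c) \<le> (\<integral>\<^sup>+ \<alpha>. ?v (n + \<alpha>) \<partial>lborel)"
      unfolding B0_norm_eq by (intro nn_integral_mono)
    also have "\<dots> = deriv_tail g n"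
      using nn_integral_real_affine[of ?v 1 n] B_spaceD(3)[OF g] by (simp add: deriv_tail_def)
    finally show ?thesis .
  qed
  ultimately show ?thesis unfolding B_norm_def mult_2 by (rule add_mono)
qed

lemma B_space_shift_diff_approx:
  assumes g: "g \<in> B_space" and e: "e > 0"
  obtains \<delta> n c where "0 < \<delta>" "\<delta> < n" "((\<lambda>x. g (complex_of_real x)) \<longlongrightarrow> c) at_top"
    "B_norm (\<lambda>z. g z - (shift_diff \<delta> n g z + c)) < ennreal e"
proof -
  obtain c where c: "\<And>z. z \<in> Cplus \<Longrightarrow> ennreal (cmod (g z - c)) \<le> deriv_tail g (Re z)"
    using B_space_limit_at_infinity[OF g] by blast
  have "((\<lambda>n. 2 * deriv_tail g n) \<longlongrightarrow> 0) at_top"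
    using ennreal_tendsto_cmult[OF _ deriv_tail_tendsto_0[OF g], of 2] by simp
  then have "\<forall>\<^sub>F n in at_top. 2 * deriv_tail g n < ennreal (e / 2)"
    by (rule order_tendstoD) (use e in simp)
  then have "\<forall>\<^sub>F n in at_top. 2 * deriv_tail g n < ennreal (e / 2) \<and> n > 0"
    using eventually_gt_at_top by (rule eventually_conj)
  then obtain n where n: "2 * deriv_tail g n < ennreal (e / 2)" "n > 0"
    by (auto dest: eventually_happens)
  have "\<forall>\<^sub>F \<delta> in at_right 0. B_norm (shift_diff 0 \<delta> g) < ennreal (e / 2)"
    using B_norm_shift_diff_tendsto_0[OF g] by (rule order_tendstoD) (use e in simp)
  then have "\<forall>\<^sub>F \<delta> in at_right 0. B_norm (shift_diff 0 \<delta> g) < ennreal (e / 2) \<and> \<delta> \<in> {0<..<n}"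
    using eventually_at_right_real[OF n(2)] by (rule eventually_conj)
  then obtain \<delta> where \<delta>: "B_norm (shift_diff 0 \<delta> g) < ennreal (e / 2)" "0 < \<delta>" "\<delta> < n"
    by (auto dest: eventually_happens)
  have hol: "g holomorphic_on Cplus" using g by (rule B_spaceD)
  have "B_norm (\<lambda>z. g z - (shift_diff \<delta> n g z + c))
      = B_norm (\<lambda>z. shift_diff 0 \<delta> g z + (g (z + of_real n) - c))"
    by (rule B_norm_cong) (simp add: shift_diff_def)
  also have "\<dots> \<le> B_norm (shift_diff 0 \<delta> g) + B_norm (\<lambda>z. g (z + of_real n) - c)"
    using hol n \<delta>
    by (intro B_norm_triangle holomorphic_on_shift_diff holomorphic_intros holomorphic_on_shift)
      auto
  also have "\<dots> < ennreal (e / 2) + ennreal (e / 2)"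
    using \<delta>(1) le_less_trans[OF B_norm_shift_minus_limit_le[OF g c, of n]] n
    by (intro add_strict_mono) auto
  also have "\<dots> = ennreal e" using e by (simp flip: ennreal_plus)
  finally show ?thesis using that \<delta> B_space_tendsto_at_top[OF g c] by blast
qed

lemma B_norm_minus_shift_diff_le:
  assumes hol: "g holomorphic_on Cplus" "h holomorphic_on Cplus" and \<delta>: "0 < \<delta>" "\<delta> \<le> n"
    and c: "((\<lambda>x. g (complex_of_real x)) \<longlongrightarrow> c) at_top"
    and c': "((\<lambda>x. h (complex_of_real x)) \<longlongrightarrow> c') at_top"
  shows "B_norm (\<lambda>z. g z - (shift_diff \<delta> n h z + c'))
    \<le> B_norm (\<lambda>z. g z - (shift_diff \<delta> n g z + c))
      + ennreal (3 + 16 * n / \<delta>) * sup_norm (\<lambda>z. g z - h z)"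
proof -
  let ?d = "\<lambda>z. g z - h z"
  have hol_d: "?d holomorphic_on Cplus" using hol by (rule holomorphic_on_diff)
  have shift_hol: "shift_diff \<delta> n f holomorphic_on Cplus" if "f holomorphic_on Cplus" for f
    using that \<delta> by (intro holomorphic_on_shift_diff) auto
  have "B_norm (\<lambda>z. g z - (shift_diff \<delta> n h z + c'))
      = B_norm (\<lambda>z. (g z - (shift_diff \<delta> n g z + c)) + (shift_diff \<delta> n ?d z + (c - c')))"
    by (rule B_norm_cong) (simp add: shift_diff_def)
  also have "\<dots> \<le> B_norm (\<lambda>z. g z - (shift_diff \<delta> n g z + c))
      + (B_norm (shift_diff \<delta> n ?d) + B_norm (\<lambda>z. c - c'))"
    by (intro order_trans[OF B_norm_triangle] add_left_mono B_norm_triangle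
        holomorphic_intros shift_hol hol hol_d)
  also have "B_norm (shift_diff \<delta> n ?d) + B_norm (\<lambda>z. c - c')
      \<le> ennreal (2 + 16 * n / \<delta>) * sup_norm ?d + sup_norm ?d"
    unfolding B_norm_const
    by (intro add_mono B_norm_shift_diff_le norm_limit_le_sup_norm tendsto_diff hol_d \<delta> c c')
  also have "\<dots> = ennreal (3 + 16 * n / \<delta>) * sup_norm ?d"
  proof -
    have "ennreal (3 + 16 * n / \<delta>) = ennreal (2 + 16 * n / \<delta>) + 1"
      using \<delta> by (simp flip: ennreal_1 ennreal_plus)
    then show ?thesis by (simp only: distrib_right mult_1)
  qed
  finally show ?thesis by (simp add: add_left_mono)
qed

lemma closure_B_subset_closure_sup: "closure_B Y \<subseteq> closure_sup Y"
  unfolding closure_B_def closure_sup_def by (blast intro: le_less_trans[OF sup_norm_le_B_norm])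

lemma closure_B_eq_closure_sup:
  assumes hol: "\<And>h. h \<in> Y \<Longrightarrow> h holomorphic_on Cplus"
    and shift: "\<And>h \<delta> n. h \<in> Y \<Longrightarrow> 0 < \<delta> \<Longrightarrow> \<delta> < n \<Longrightarrow>
      \<exists>h'\<in>Y. \<exists>c. ((\<lambda>x. h (complex_of_real x)) \<longlongrightarrow> c) at_top \<and>
        (\<forall>z\<in>Cplus. h' z = shift_diff \<delta> n h z + c)"
  shows "closure_B Y = closure_sup Y"
proof (intro equalityI closure_B_subset_closure_sup subsetI)
  fix g assume g_closure: "g \<in> closure_sup Y"
  then have g: "g \<in> B_space" by (simp add: closure_sup_def)
  have "\<exists>h\<in>Y. B_norm (\<lambda>z. g z - h z) < ennreal e" if "e > 0" for e
  proof -
    obtain \<delta> n c where \<delta>: "0 < \<delta>" "\<delta> < n" and c: "((\<lambda>x. g (complex_of_real x)) \<longlongrightarrow> c) at_top"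
      and g_approx: "B_norm (\<lambda>z. g z - (shift_diff \<delta> n g z + c)) < ennreal (e / 2)"
      using B_space_shift_diff_approx[OF g, of "e / 2"] \<open>e > 0\<close> by auto
    define K where "K = 3 + 16 * n / \<delta>"
    have "K > 0" using \<delta> by (simp add: K_def add_pos_nonneg)
    with \<open>e > 0\<close> have "e / 2 / K > 0" by simp
    then obtain h where h: "h \<in> Y" "sup_norm (\<lambda>z. g z - h z) < ennreal (e / 2 / K)"
      using g_closure unfolding closure_sup_def by blast
    obtain h' c' where h': "h' \<in> Y" "((\<lambda>x. h (complex_of_real x)) \<longlongrightarrow> c') at_top"
       "\<And>z. z \<in> Cplus \<Longrightarrow> h' z = shift_diff \<delta> n h z + c'"
      using shift[OF h(1) \<delta>] by blast
    have "B_norm (\<lambda>z. g z - h' z) = B_norm (\<lambda>z. g z - (shift_diff \<delta> n h z + c'))"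
      by (rule B_norm_cong) (simp add: h')
    also have
      "\<dots> \<le> B_norm (\<lambda>z. g z - (shift_diff \<delta> n g z + c)) + ennreal K * sup_norm (\<lambda>z. g z - h z)"
      unfolding K_def using \<delta> by (intro B_norm_minus_shift_diff_le B_spaceD[OF g] hol h c h') auto
    also have "ennreal K * sup_norm (\<lambda>z. g z - h z) \<le> ennreal K * ennreal (e / 2 / K)"
      using h by (intro mult_left_mono) auto
    also have "\<dots> = ennreal (e / 2)" using \<open>K > 0\<close> by (simp flip: ennreal_mult')
    also have
      "B_norm (\<lambda>z. g z - (shift_diff \<delta> n g z + c)) + ennreal (e / 2)
          < ennreal (e / 2) + ennreal (e / 2)"
      using g_approx by (simp add: ennreal_add_left_cancel_less add.commute)
    also have "\<dots> = ennreal e" using \<open>e > 0\<close> by (simp flip: ennreal_plus)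
    finally show ?thesis using h'(1) by (auto simp: add_left_mono)
  qed
  then show "g \<in> closure_B Y" using g by (simp add: closure_B_def)
qed

section \<open>Laplace transforms of measures\<close>

abbreviation laplace_kernel :: "complex \<Rightarrow> real \<Rightarrow> complex" where
  "laplace_kernel z t \<equiv> exp (- (z * complex_of_real t))"

lemma norm_laplace_kernel: "cmod (laplace_kernel z t) = exp (- (Re z * t))"
  by (simp add: norm_exp_eq_Re)

lemma norm_laplace_kernel_le_1: "Re z \<ge> 0 \<Longrightarrow> t \<ge> 0 \<Longrightarrow> cmod (laplace_kernel z t) \<le> 1"
  by (simp add: norm_laplace_kernel)

lemma laplace_kernel_shift:
  "laplace_kernel (z + of_real a) t = exp (- (a * t)) *\<^sub>R laplace_kernel z t"
  by (simp add: scaleR_conv_of_real algebra_simps flip: exp_of_real exp_add)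

lemma laplace_kernel_holomorphic: "(\<lambda>z. laplace_kernel z t) holomorphic_on S"
  by (intro holomorphic_intros)

lemma pos_meas_RplusD:
  assumes "pos_meas_Rplus M"
  shows "sets M = sets borel" "finite_measure M" "AE t in M. t \<ge> 0"
proof -
  show "sets M = sets borel" "finite_measure M" using assms by (auto simp: pos_meas_Rplus_def)
  show "AE t in M. t \<ge> 0"
    using assms by (intro AE_I[of M _ "{..<0}"]) (auto simp: pos_meas_Rplus_def)
qed

lemma laplace_kernel_measurable:
  assumes "sets M = sets borel"
  shows "laplace_kernel z \<in> borel_measurable M"
  unfolding measurable_cong_sets[OF assms refl] by measurable

lemma integrable_laplace_kernel:
  assumes M: "pos_meas_Rplus M" and z: "Re z \<ge> 0"
  shows "integrable M (laplace_kernel z)"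
proof (rule finite_measure.integrable_const_bound[where B = 1])
  show "AE t in M. cmod (laplace_kernel z t) \<le> 1"
    using pos_meas_RplusD(3)[OF M] by eventually_elim (intro norm_laplace_kernel_le_1 z)
qed (intro pos_meas_RplusD[OF M] laplace_kernel_measurable)+

lemma laplace_pos_holomorphic:
  assumes M: "pos_meas_Rplus M"
  shows "laplace_pos M holomorphic_on Cplus"
proof -
  interpret finite_measure M using M by (rule pos_meas_RplusD)
  have "((\<lambda>z. LINT t|M. laplace_kernel z t) has_field_derivative
      (LINT t|M. deriv (\<lambda>z. laplace_kernel z t) z)) (at z)" if "z \<in> Cplus" for z
  proof (rule has_field_derivative_integral_holomorphic[OF open_Cplus that])
    show "integrable M (\<lambda>_. 1 :: real)" by simp
    show "AE t in M. \<forall>z\<in>Cplus. cmod (laplace_kernel z t) \<le> 1"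
      using pos_meas_RplusD(3)[OF M]
      by eventually_elim (auto intro!: norm_laplace_kernel_le_1 simp: Cplus_def)
  qed (use pos_meas_RplusD(1)[OF M] in \<open>auto intro: laplace_kernel_measurable
    laplace_kernel_holomorphic\<close>)
  then show ?thesis
    using open_Cplus unfolding laplace_pos_def[abs_def] by (auto simp: holomorphic_on_open)
qed

lemma laplace_kernel_tendsto_0:
  assumes "Re z > 0"
  shows "(laplace_kernel z \<longlongrightarrow> 0) at_top"
proof -
  have "((\<lambda>t. exp (- Re z * t)) \<longlongrightarrow> 0) at_top"
    using assms
    by (intro filterlim_compose[OF exp_at_bot]
        filterlim_tendsto_neg_mult_at_bot[OF tendsto_const _ filterlim_ident]) simp
  moreover have "exp (- Re z * t) = cmod (laplace_kernel z t)" for t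
    by (simp add: norm_laplace_kernel)
  ultimately show ?thesis by (simp only: tendsto_norm_zero_iff)
qed

lemma laplace_kernel_tendsto_indicator:
  assumes "t \<ge> 0"
  shows "((\<lambda>x. laplace_kernel (of_real x) t) \<longlongrightarrow> of_real (indicator {0} t)) at_top"
proof (cases "t = 0")
  case False
  with assms have "(laplace_kernel (of_real t) \<longlongrightarrow> 0) at_top"
    by (intro laplace_kernel_tendsto_0) simp
  then show ?thesis using False by (simp add: mult.commute)
qed simp

lemma has_bochner_integral_indicator_0:
  assumes "pos_meas_Rplus M"
  shows "has_bochner_integral M (\<lambda>t. complex_of_real (indicator {0} t)) (of_real (measure M {0}))"
proof -
  interpret finite_measure M using assms by (rule pos_meas_RplusD)
  show ?thesis
    using pos_meas_RplusD(1)[OF assms]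
    by (intro has_bochner_integral_of_real has_bochner_integral_real_indicator)
      (auto simp: emeasure_finite less_top[symmetric])
qed

lemma laplace_pos_at_top:
  assumes M: "pos_meas_Rplus M"
  shows "((\<lambda>x. laplace_pos M (of_real x)) \<longlongrightarrow> of_real (measure M {0})) at_top"
proof -
  interpret finite_measure M using M by (rule pos_meas_RplusD)
  note [measurable_cong] = pos_meas_RplusD(1)[OF M]
  have "((\<lambda>x. LINT t|M. laplace_kernel (of_real x) t)
      \<longlongrightarrow> (LINT t|M. of_real (indicator {0} t))) at_top"
  proof (rule integral_dominated_convergence_at_top[where w = "\<lambda>_. 1"])
    show "AE t in M. ((\<lambda>x. laplace_kernel (of_real x) t) \<longlongrightarrow> of_real (indicator {0} t)) at_top"
      using pos_meas_RplusD(3)[OF M] by eventually_elim (rule laplace_kernel_tendsto_indicator)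
    show "\<forall>\<^sub>F x in at_top. AE t in M. cmod (laplace_kernel (of_real x) t) \<le> 1"
      using eventually_ge_at_top[of 0]
    proof eventually_elim
      case (elim x)
      show ?case
        using pos_meas_RplusD(3)[OF M] by eventually_elim
          (use elim in \<open>simp add: norm_laplace_kernel\<close>)
    qed
  qed auto
  then show ?thesis
    using has_bochner_integral_integral_eq[OF has_bochner_integral_indicator_0[OF M]]
    unfolding laplace_pos_def by simp
qed

lemma pos_meas_Rplus_density:
  assumes sets_M: "sets M = sets borel" and w: "integrable M w" "AE t in M. w t \<ge> 0"
    and neg: "AE t in M. t < 0 \<longrightarrow> w t = 0"
  shows "pos_meas_Rplus (density M (\<lambda>t. ennreal (w t)))"
proof -
  have space: "space M = UNIV" using sets_eq_imp_space_eq[OF sets_M] by simp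
  have [measurable]: "w \<in> borel_measurable M" using w(1) by simp
  have "emeasure (density M (\<lambda>t. ennreal (w t))) UNIV = ennreal (LINT t|M. w t)"
    using nn_integral_eq_integral[OF w] sets.top[of M] by (simp add: emeasure_density space)
  then have "finite_measure (density M (\<lambda>t. ennreal (w t)))"
    by (intro finite_measureI) (simp add: space)
  moreover have "emeasure (density M (\<lambda>t. ennreal (w t))) {..<0} = (\<integral>\<^sup>+ t. 0 \<partial>M)"
  proof (subst emeasure_density)
    show "(\<integral>\<^sup>+ t. ennreal (w t) * indicator {..<0} t \<partial>M) = (\<integral>\<^sup>+ t. 0 \<partial>M)"
      using neg by (intro nn_integral_cong_AE) (auto simp: indicator_def)
  qed (auto simp: sets_M)
  ultimately show ?thesis by (simp add: pos_meas_Rplus_def sets_M)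
qed

text \<open>On measures, the map \<open>f \<mapsto> f(\<cdot> + \<delta>) - f(\<cdot> + n) + f(\<infinity>)\<close> is multiplication by this weight;
  the value 1 at 0 accounts for the limit at infinity.\<close>

definition shift_weight :: "real \<Rightarrow> real \<Rightarrow> real \<Rightarrow> real" where
  "shift_weight \<delta> n t = exp (- (\<delta> * t)) - exp (- (n * t)) + indicator {0} t"

definition shift_density :: "real \<Rightarrow> real \<Rightarrow> real measure \<Rightarrow> real measure" where
  "shift_density \<delta> n M = density M (\<lambda>t. ennreal (shift_weight \<delta> n t))"

lemma shift_weight_measurable [measurable]: "shift_weight \<delta> n \<in> borel_measurable borel"
  unfolding shift_weight_def[abs_def] by measurable

lemma shift_weight_bounds:
  assumes "0 \<le> \<delta>" "\<delta> \<le> n" "t \<ge> 0"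
  shows "0 \<le> shift_weight \<delta> n t" "shift_weight \<delta> n t \<le> 1"
proof -
  have "exp (- (n * t)) \<le> exp (- (\<delta> * t))" "exp (- (\<delta> * t)) \<le> 1" "exp (- (n * t)) > 0"
    using assms by (auto intro: mult_right_mono)
  then have "0 \<le> exp (- (\<delta> * t)) - exp (- (n * t))" "exp (- (\<delta> * t)) - exp (- (n * t)) \<le> 1"
    by linarith+
  then show "0 \<le> shift_weight \<delta> n t" "shift_weight \<delta> n t \<le> 1"
    by (auto simp: shift_weight_def indicator_def)
qed

context
  fixes M :: "real measure" and \<delta> n :: real
  assumes M: "pos_meas_Rplus M" and \<delta>: "0 \<le> \<delta>" "\<delta> \<le> n"
begin

lemma shift_weight_measurable_pos_meas: "shift_weight \<delta> n \<in> borel_measurable M"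
  unfolding measurable_cong_sets[OF pos_meas_RplusD(1)[OF M] refl] by measurable

lemma AE_shift_weight_bounds:
  "AE t in M. shift_weight \<delta> n t \<ge> 0" "AE t in M. shift_weight \<delta> n t \<le> 1"
  using pos_meas_RplusD(3)[OF M] by (eventually_elim, simp add: shift_weight_bounds \<delta>)+

lemma pos_meas_Rplus_shift_density: "pos_meas_Rplus (shift_density \<delta> n M)"
  unfolding shift_density_def
proof (rule pos_meas_Rplus_density)
  interpret finite_measure M using M by (rule pos_meas_RplusD)
  show "integrable M (shift_weight \<delta> n)"
  proof (rule integrable_const_bound)
    show "AE t in M. norm (shift_weight \<delta> n t) \<le> 1"
      using AE_shift_weight_bounds by eventually_elim simp
  qed (rule shift_weight_measurable_pos_meas)
  show "AE t in M. t < 0 \<longrightarrow> shift_weight \<delta> n t = 0"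
    using pos_meas_RplusD(3)[OF M] by eventually_elim simp
qed (rule pos_meas_RplusD[OF M] AE_shift_weight_bounds)+

lemma absolutely_continuous_shift_density: "absolutely_continuous M (shift_density \<delta> n M)"
  unfolding shift_density_def using shift_weight_measurable_pos_meas
  by (intro absolutely_continuousI_density measurable_compose[OF _ measurable_ennreal])

lemma laplace_pos_shift_density:
  assumes z: "z \<in> Cplus"
  shows
    "laplace_pos (shift_density \<delta> n M) z
        = shift_diff \<delta> n (laplace_pos M) z + of_real (measure M {0})"
proof -
  have "integrable M (laplace_kernel (z + of_real \<delta>))"
    "integrable M (laplace_kernel (z + of_real n))"
    using z \<delta> by (auto intro!: integrable_laplace_kernel[OF M] simp: Cplus_def)
  moreover have "shift_weight \<delta> n t *\<^sub>R laplace_kernel z t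
      = laplace_kernel (z + of_real \<delta>) t - laplace_kernel (z + of_real n) t
        + of_real (indicator {0} t)" for t
    unfolding laplace_kernel_shift
    by (simp add: shift_weight_def scaleR_left_diff_distrib indicator_def)
  moreover have
    "laplace_pos (shift_density \<delta> n M) z = (LINT t|M. shift_weight \<delta> n t *\<^sub>R laplace_kernel z t)"
    unfolding laplace_pos_def shift_density_def using AE_shift_weight_bounds(1)
    by (intro integral_density laplace_kernel_measurable pos_meas_RplusD(1)[OF M]
      shift_weight_measurable_pos_meas)
  ultimately show ?thesis
    using has_bochner_integral_indicator_0[OF M]
    by (simp add: shift_diff_def laplace_pos_def has_bochner_integral_iff)
qed

end

definition jordan_sum :: "('a \<Rightarrow> complex) \<Rightarrow> 'a \<Rightarrow> 'a \<Rightarrow> 'a \<Rightarrow> 'a \<Rightarrow> complex" where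
  "jordan_sum F M1 M2 M3 M4 = F M1 - F M2 + \<i> * (F M3 - F M4)"

lemma laplace_classE:
  assumes "h \<in> laplace_class P"
  obtains M1 M2 M3 M4 where "h = (\<lambda>z. jordan_sum (\<lambda>M. laplace_pos M z) M1 M2 M3 M4)"
    "\<And>M. M \<in> {M1, M2, M3, M4} \<Longrightarrow> pos_meas_Rplus M" "\<And>M. M \<in> {M1, M2, M3, M4} \<Longrightarrow> P M"
  using assms unfolding laplace_class_def jordan_sum_def by blast

lemma laplace_classI:
  assumes "\<And>M. M \<in> {M1, M2, M3, M4} \<Longrightarrow> pos_meas_Rplus M \<and> P M"
  shows "(\<lambda>z. jordan_sum (\<lambda>M. laplace_pos M z) M1 M2 M3 M4) \<in> laplace_class P"
  unfolding laplace_class_def jordan_sum_def using assms by blast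

lemma tendsto_jordan_sum:
  assumes "\<And>M. M \<in> {M1, M2, M3, M4} \<Longrightarrow> (F M \<longlongrightarrow> L M) A"
  shows "((\<lambda>x. jordan_sum (\<lambda>M. F M x) M1 M2 M3 M4) \<longlongrightarrow> jordan_sum L M1 M2 M3 M4) A"
  unfolding jordan_sum_def using assms by (intro tendsto_intros) auto

lemma laplace_class_holomorphic:
  assumes "h \<in> laplace_class P"
  shows "h holomorphic_on Cplus"
  using assms
  by (elim laplace_classE)
    (auto simp: jordan_sum_def intro!: holomorphic_intros laplace_pos_holomorphic)

lemma laplace_class_closures_eq:
  assumes P: "\<And>M N. pos_meas_Rplus M \<Longrightarrow> pos_meas_Rplus N \<Longrightarrow> absolutely_continuous M N \<Longrightarrow> P M \<Longrightarrow> P N"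
  shows "closure_B (laplace_class P) = closure_sup (laplace_class P)"
proof (rule closure_B_eq_closure_sup[OF laplace_class_holomorphic])
  fix h \<delta> n assume "h \<in> laplace_class P" and \<delta>: "0 < \<delta>" "\<delta> < (n :: real)"
  then obtain M1 M2 M3 M4 where h: "h = (\<lambda>z. jordan_sum (\<lambda>M. laplace_pos M z) M1 M2 M3 M4)"
    and M: "\<And>M. M \<in> {M1, M2, M3, M4} \<Longrightarrow> pos_meas_Rplus M" "\<And>M. M \<in> {M1, M2, M3, M4} \<Longrightarrow> P M"
    by (elim laplace_classE) (rule that)
  let ?S = "shift_density \<delta> n"
  define h' where "h' z = jordan_sum (\<lambda>M. laplace_pos M z) (?S M1) (?S M2) (?S M3) (?S M4)" for z
  define c where "c = jordan_sum (\<lambda>M. of_real (measure M {0})) M1 M2 M3 M4"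
  have "pos_meas_Rplus (?S M) \<and> P (?S M)" if "M \<in> {M1, M2, M3, M4}" for M
    using P[OF M(1) pos_meas_Rplus_shift_density absolutely_continuous_shift_density M(2)]
      pos_meas_Rplus_shift_density M(1) that \<delta> by auto
  then have "h' \<in> laplace_class P" unfolding h'_def[abs_def] by (intro laplace_classI) auto
  moreover have "((\<lambda>x. h (of_real x)) \<longlongrightarrow> c) at_top"
    unfolding h c_def using M(1) by (intro tendsto_jordan_sum laplace_pos_at_top)
  moreover have "h' z = shift_diff \<delta> n h z + c" if "z \<in> Cplus" for z
    using M(1) \<delta> that
    by (simp add: h'_def h c_def jordan_sum_def laplace_pos_shift_density shift_diff_def
      algebra_simps)
  ultimately show "\<exists>h'\<in>laplace_class P. \<exists>c. ((\<lambda>x. h (of_real x)) \<longlongrightarrow> c) at_top \<and>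
      (\<forall>z\<in>Cplus. h' z = shift_diff \<delta> n h z + c)"
    by blast
qed

lemma LM_closures_eq: "closure_B LM = closure_sup LM"
  unfolding LM_def by (rule laplace_class_closures_eq) simp

lemma LL1_closures_eq: "closure_B LL1 = closure_sup LL1"
  unfolding LL1_def by (rule laplace_class_closures_eq) (auto simp: absolutely_continuous_def)

lemma LMd_closures_eq: "closure_B LMd = closure_sup LMd"
  unfolding LMd_def
proof (rule laplace_class_closures_eq, elim exE conjE)
  fix M N and A :: "real set"
  assume M: "pos_meas_Rplus M" "absolutely_continuous M N"
    and A: "countable A" "emeasure M (UNIV - A) = 0"
  have "UNIV - A \<in> sets M"
    using sets.countable[OF _ A(1), of borel] pos_meas_RplusD(1)[OF M(1)] by (simp add: sets.Diff)
  then show "\<exists>A. countable A \<and> emeasure N (UNIV - A) = 0"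
    using A emeasure_eq_0_absolutely_continuous[OF M(2)] by auto
qed

lemma LMs_closures_eq: "closure_B LMs = closure_sup LMs"
  unfolding LMs_def
proof (rule laplace_class_closures_eq, elim conjE bexE, intro conjI allI)
  fix M N and A :: "real set"
  assume M: "pos_meas_Rplus M" "absolutely_continuous M N"
    and A: "A \<in> sets borel" "emeasure lborel A = 0" "emeasure M (UNIV - A) = 0"
    and atomless: "\<forall>x. emeasure M {x} = 0"
  note sets_M = pos_meas_RplusD(1)[OF M(1)]
  have "UNIV - A \<in> sets M" using A(1) sets_M by auto
  then show "\<exists>A\<in>sets borel. emeasure lborel A = 0 \<and> emeasure N (UNIV - A) = 0"
    using A emeasure_eq_0_absolutely_continuous[OF M(2)] by auto
  show "emeasure N {x} = 0" for x
    using emeasure_eq_0_absolutely_continuous[OF M(2), of "{x}"] atomless sets_M by simp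
qed

section \<open>Laplace transforms of integrable functions\<close>

definition laplace_fun :: "(real \<Rightarrow> complex) \<Rightarrow> complex \<Rightarrow> complex" where
  "laplace_fun u z = (LINT t:{0..}|lborel. u t * laplace_kernel z t)"

lemma norm_laplace_integrand_le:
  assumes "C \<ge> 0" and "\<And>t. t \<ge> 0 \<Longrightarrow> u t \<noteq> 0 \<Longrightarrow> cmod (laplace_kernel z t) \<le> C"
  shows "cmod (indicator {0..} t *\<^sub>R (u t * laplace_kernel z t)) \<le> C * cmod (u t)"
proof (cases "t \<ge> 0 \<and> u t \<noteq> 0")
  case True
  then have "cmod (laplace_kernel z t) * cmod (u t) \<le> C * cmod (u t)"
    using assms by (intro mult_right_mono) auto
  then show ?thesis using True by (simp add: norm_mult mult.commute)
qed (use \<open>C \<ge> 0\<close> in \<open>auto simp: indicator_def\<close>)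

lemma set_integrable_laplace_fun:
  assumes u: "integrable lborel u" and "C \<ge> 0"
    and bound: "\<And>t. t \<ge> 0 \<Longrightarrow> u t \<noteq> 0 \<Longrightarrow> cmod (laplace_kernel z t) \<le> C"
  shows "set_integrable lborel {0..} (\<lambda>t. u t * laplace_kernel z t)"
  unfolding set_integrable_def
proof (rule Bochner_Integration.integrable_bound)
  have [measurable]: "u \<in> borel_measurable borel" using borel_measurable_integrable[OF u] by simp
  show "integrable lborel (\<lambda>t. C * cmod (u t))" using u by simp
  show "(\<lambda>t. indicator {0..} t *\<^sub>R (u t * laplace_kernel z t))
      \<in> borel_measurable lborel" by measurable
  show "AE t in lborel. norm (indicator {0..} t *\<^sub>R (u t * laplace_kernel z t))
      \<le> norm (C * cmod (u t))"
    using norm_laplace_integrand_le[OF assms(2,3)] \<open>C \<ge> 0\<close> by simp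
qed

lemma norm_laplace_fun_le:
  assumes u: "integrable lborel u" and C: "C \<ge> 0"
    and bound: "\<And>t. t \<ge> 0 \<Longrightarrow> u t \<noteq> 0 \<Longrightarrow> cmod (laplace_kernel z t) \<le> C"
  shows "cmod (laplace_fun u z) \<le> C * (LINT t|lborel. cmod (u t))"
proof -
  have "cmod (laplace_fun u z) \<le> (LINT t|lborel. C * cmod (u t))"
    unfolding laplace_fun_def set_lebesgue_integral_def
  proof (rule Bochner_Integration.integral_norm_bound_integral)
    show "integrable lborel (\<lambda>t. indicator {0..} t *\<^sub>R (u t * laplace_kernel z t))"
      using set_integrable_laplace_fun[OF u C bound] by (simp add: set_integrable_def)
    show "cmod (indicator {0..} t *\<^sub>R (u t * laplace_kernel z t)) \<le> C * cmod (u t)" for t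
      by (intro norm_laplace_integrand_le C bound)
  qed (use u in simp)
  then show ?thesis by simp
qed

lemmas set_integrable_laplace_fun_half_plane =
  set_integrable_laplace_fun[OF _ zero_le_one norm_laplace_kernel_le_1]

lemmas norm_laplace_fun_le_half_plane =
  norm_laplace_fun_le[OF _ zero_le_one norm_laplace_kernel_le_1, unfolded mult_1]

lemma laplace_fun_add:
  assumes "integrable lborel u" "integrable lborel v" "Re z \<ge> 0"
  shows "laplace_fun (\<lambda>t. u t + v t) z = laplace_fun u z + laplace_fun v z"
  unfolding laplace_fun_def distrib_right
  using assms by (intro set_integral_add set_integrable_laplace_fun_half_plane)

lemma laplace_fun_diff:
  assumes "integrable lborel u" "integrable lborel v" "Re z \<ge> 0"
  shows "laplace_fun (\<lambda>t. u t - v t) z = laplace_fun u z - laplace_fun v z"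
  unfolding laplace_fun_def left_diff_distrib
  using assms by (intro set_integral_diff set_integrable_laplace_fun_half_plane)

lemma laplace_fun_cmult: "laplace_fun (\<lambda>t. c * u t) z = c * laplace_fun u z"
  by (simp add: laplace_fun_def mult.assoc)

lemma laplace_fun_sum:
  assumes "\<And>i. i \<in> I \<Longrightarrow> integrable lborel (u i)" "Re z \<ge> 0"
  shows "laplace_fun (\<lambda>t. \<Sum>i\<in>I. u i t) z = (\<Sum>i\<in>I. laplace_fun (u i) z)"
  using assms(1)
proof (induction I rule: infinite_finite_induct)
  case (insert i I)
  then show ?case by (simp add: laplace_fun_add assms(2))
qed (simp_all add: laplace_fun_def)

lemma laplace_fun_has_field_derivative:
  assumes u: "integrable lborel u" and S: "open S" "z \<in> S"
    and bound: "\<And>z t. z \<in> S \<Longrightarrow> t \<ge> 0 \<Longrightarrow> u t \<noteq> 0 \<Longrightarrow> cmod (laplace_kernel z t) \<le> C" and C: "C \<ge> 0"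
  shows "(laplace_fun u has_field_derivative laplace_fun (\<lambda>t. - of_real t * u t) z) (at z)"
proof -
  let ?f = "\<lambda>z t. indicator {0..} t *\<^sub>R (u t * laplace_kernel z t)"
  have [measurable]: "u \<in> borel_measurable borel" using borel_measurable_integrable[OF u] by simp
  have "((\<lambda>z. LINT t|lborel. ?f z t)
      has_field_derivative (LINT t|lborel. deriv (\<lambda>z. ?f z t) z)) (at z)"
  proof (rule has_field_derivative_integral_holomorphic[OF S])
    show "integrable lborel (\<lambda>t. C * cmod (u t))" using u by simp
    show "?f z \<in> borel_measurable lborel" for z by measurable
    show "(\<lambda>z. ?f z t) holomorphic_on S" for t
      unfolding scaleR_conv_of_real by (intro holomorphic_intros)
    show "AE t in lborel. \<forall>z\<in>S. cmod (?f z t) \<le> C * cmod (u t)"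
      by (intro AE_I2 ballI norm_laplace_integrand_le C bound)
  qed
  moreover have
    "deriv (\<lambda>z. ?f z t) z = indicator {0..} t *\<^sub>R (- of_real t * u t * laplace_kernel z t)" for t
    by (rule DERIV_imp_deriv)
      (auto simp: scaleR_conv_of_real intro!: derivative_eq_intros)
  ultimately show ?thesis by (simp add: laplace_fun_def[abs_def] set_lebesgue_integral_def)
qed

section \<open>The Riemann-Lebesgue lemma\<close>

lemma norm_laplace_fun_interval_le:
  assumes z: "z \<in> Cplus_cl" "z \<noteq> 0"
  shows "cmod (laplace_fun (\<lambda>t. indicator {a..b} t *\<^sub>R c) z) \<le> 2 * cmod c / cmod z"
proof -
  let ?I = "{max 0 a..b}"
  have eq:
    "laplace_fun (\<lambda>t. indicator {a..b} t *\<^sub>R c) z = c * (LINT t:?I|lborel. laplace_kernel z t)"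
    unfolding laplace_fun_def set_integral_mult_right[symmetric] unfolding set_lebesgue_integral_def
    by (intro Bochner_Integration.integral_cong) (auto simp: indicator_def)
  show ?thesis
  proof (cases "max 0 a \<le> b")
    case True
    then have "cmod (laplace_kernel z (max 0 a)) + cmod (laplace_kernel z b) \<le> 1 + 1"
      using z by (intro add_mono norm_laplace_kernel_le_1) (auto simp: Cplus_cl_def)
    then have "cmod (laplace_kernel z (max 0 a) - laplace_kernel z b) \<le> 2"
      using norm_triangle_ineq4 order_trans by (metis one_add_one)
    then have
      "cmod c * cmod (laplace_kernel z (max 0 a) - laplace_kernel z b) / cmod z
          \<le> cmod c * 2 / cmod z"
      by (intro divide_right_mono mult_left_mono) auto
    then show ?thesis
      using True z by (simp add: eq set_integral_exp_Icc norm_mult norm_divide mult.commute)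
  qed (simp add: eq set_lebesgue_integral_def)
qed

lemma laplace_fun_interval_tendsto_0:
  "(laplace_fun (\<lambda>t. indicator {a..b} t *\<^sub>R c) \<longlongrightarrow> 0) (at_infinity_within Cplus_cl)"
proof (rule Lim_null_comparison)
  have "\<forall>\<^sub>F z in at_infinity. z \<noteq> (0::complex)"
    by (auto simp: eventually_at_infinity intro!: exI[of _ 1])
  then show "\<forall>\<^sub>F z in at_infinity_within Cplus_cl.
      cmod (laplace_fun (\<lambda>t. indicator {a..b} t *\<^sub>R c) z) \<le> 2 * cmod c / cmod z"
    unfolding eventually_inf_principal by eventually_elim (simp add: norm_laplace_fun_interval_le)
  show "((\<lambda>z. 2 * cmod c / cmod z) \<longlongrightarrow> 0) (at_infinity_within Cplus_cl)"
    by (intro tendsto_mono[OF inf_le1] tendsto_divide_0[OF tendsto_const]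
        filterlim_at_top_imp_at_infinity filterlim_norm_at_top)
qed

lemma uniform_limit_laplace_fun:
  assumes int: "integrable lborel u" "\<And>i::nat. integrable lborel (s i)"
    and lim: "(\<lambda>i. LINT t|lborel. cmod (s i t - u t)) \<longlonglongrightarrow> 0"
  shows "uniform_limit Cplus_cl (\<lambda>i. laplace_fun (s i)) (laplace_fun u) sequentially"
proof (rule uniform_limitI)
  fix e :: real assume "e > 0"
  with lim have "\<forall>\<^sub>F i in sequentially. (LINT t|lborel. cmod (s i t - u t)) < e"
    by (rule order_tendstoD)
  then show "\<forall>\<^sub>F i in sequentially. \<forall>z\<in>Cplus_cl. dist (laplace_fun (s i) z) (laplace_fun u z) < e"
  proof (eventually_elim, intro ballI)
    fix i z assume i: "(LINT t|lborel. cmod (s i t - u t)) < e" and "z \<in> Cplus_cl"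
    then have z: "Re z \<ge> 0" by (simp add: Cplus_cl_def)
    have "cmod (laplace_fun (\<lambda>t. s i t - u t) z) \<le> (LINT t|lborel. cmod (s i t - u t))"
      using int z by (intro norm_laplace_fun_le_half_plane) auto
    then show "dist (laplace_fun (s i) z) (laplace_fun u z) < e"
      using i z int by (simp add: dist_norm laplace_fun_diff)
  qed
qed

lemma laplace_fun_Riemann_Lebesgue:
  assumes "integrable lborel u"
  shows "(laplace_fun u \<longlongrightarrow> 0) (at_infinity_within Cplus_cl)"
proof (rule integrable_lborel_induct[OF _ _ _ assms])
  fix a b c
  show "(laplace_fun (\<lambda>t. indicator {a..b} t *\<^sub>R c) \<longlongrightarrow> 0) (at_infinity_within Cplus_cl)"
    by (rule laplace_fun_interval_tendsto_0)
next
  fix u v assume int: "integrable lborel u" "integrable lborel v"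
    and lim: "(laplace_fun u \<longlongrightarrow> 0) (at_infinity_within Cplus_cl)"
      "(laplace_fun v \<longlongrightarrow> 0) (at_infinity_within Cplus_cl)"
  have "\<forall>\<^sub>F z in at_infinity_within Cplus_cl. laplace_fun u z + laplace_fun v z
      = laplace_fun (\<lambda>t. u t + v t) z"
    unfolding eventually_inf_principal
    by (rule always_eventually) (auto simp: laplace_fun_add int Cplus_cl_def)
  with tendsto_add[OF lim] show "(laplace_fun (\<lambda>t. u t + v t) \<longlongrightarrow> 0) (at_infinity_within Cplus_cl)"
    by (auto intro: Lim_transform_eventually)
next
  fix u and s :: "nat \<Rightarrow> real \<Rightarrow> complex"
  assume "integrable lborel u" "\<And>i. integrable lborel (s i)"
    "(\<lambda>i. LINT t|lborel. cmod (s i t - u t)) \<longlonglongrightarrow> 0"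
  then have "uniform_limit Cplus_cl (\<lambda>i. laplace_fun (s i)) (laplace_fun u) sequentially"
    by (rule uniform_limit_laplace_fun)
  moreover assume "\<And>i. (laplace_fun (s i) \<longlongrightarrow> 0) (at_infinity_within Cplus_cl)"
  ultimately show "(laplace_fun u \<longlongrightarrow> 0) (at_infinity_within Cplus_cl)"
    by (intro swap_uniform_limit'[where f = "\<lambda>i. laplace_fun (s i)" and g = "\<lambda>_. 0"
          and F = sequentially])
      (auto simp: eventually_inf_principal)
qed

section \<open>Laplace transforms of absolutely continuous measures\<close>

lemma laplace_pos_density:
  assumes [measurable]: "u \<in> borel_measurable borel" and u: "\<And>t. u t \<ge> 0"
    and M: "pos_meas_Rplus (density lborel (\<lambda>t. ennreal (u t)))"
  shows "laplace_pos (density lborel (\<lambda>t. ennreal (u t))) z = laplace_fun (\<lambda>t. of_real (u t)) z"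
proof -
  let ?M = "density lborel (\<lambda>t. ennreal (u t))"
  have "laplace_pos ?M z = (LINT t|?M. indicator {0..} t *\<^sub>R laplace_kernel z t)"
    unfolding laplace_pos_def
  proof (rule integral_cong_AE)
    show "AE t in ?M. laplace_kernel z t = indicator {0..} t *\<^sub>R laplace_kernel z t"
      using pos_meas_RplusD(3)[OF M] by eventually_elim simp
  qed measurable
  also have "\<dots> = (LINT t|lborel. u t *\<^sub>R (indicator {0..} t *\<^sub>R laplace_kernel z t))"
    using u by (intro integral_density) auto
  also have "\<dots> = laplace_fun (\<lambda>t. of_real (u t)) z"
    unfolding laplace_fun_def set_lebesgue_integral_def
    by (intro Bochner_Integration.integral_cong) (auto simp: scaleR_conv_of_real)
  finally show ?thesis .
qed

lemma pos_meas_Rplus_abs_continuousE: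
  assumes M: "pos_meas_Rplus M" and ac: "absolutely_continuous lborel M"
  obtains u where "integrable lborel u" "\<And>t. u t \<ge> 0" "M = density lborel (\<lambda>t. ennreal (u t))"
proof -
  interpret M: finite_measure M using M by (rule pos_meas_RplusD)
  have sets_M: "sets M = sets lborel" using pos_meas_RplusD(1)[OF M] by simp
  obtain u
    where u: "u \<in> borel_measurable lborel" "AE t in lborel. RN_deriv lborel M t = ennreal (u t)"
    "\<And>t. u t \<ge> 0"
    using sigma_finite_measure.real_RN_deriv[OF lborel.sigma_finite_measure_axioms
      M.finite_measure_axioms ac sets_M]
    by blast
  have "M = density lborel (RN_deriv lborel M)"
    by (rule sigma_finite_measure.density_RN_deriv[OF lborel.sigma_finite_measure_axioms ac sets_M,
      symmetric])
  also have "\<dots> = density lborel (\<lambda>t. ennreal (u t))"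
    using u by (intro density_cong) auto
  finally have M_eq: "M = density lborel (\<lambda>t. ennreal (u t))" .
  have "(\<integral>\<^sup>+ t. ennreal (u t) \<partial>lborel) = emeasure M UNIV"
    unfolding M_eq using u(1) by (simp add: emeasure_density)
  then have "integrable lborel u"
    using u by (intro integrableI_nonneg) (auto simp: M.emeasure_eq_measure)
  with u M_eq show ?thesis using that by blast
qed

lemma LL1_tendsto_0:
  assumes "h \<in> LL1"
  shows "(h \<longlongrightarrow> 0) (at_infinity_within Cplus_cl)"
proof -
  obtain M1 M2 M3 M4 where h: "h = (\<lambda>z. jordan_sum (\<lambda>M. laplace_pos M z) M1 M2 M3 M4)"
    and M: "\<And>M. M \<in> {M1, M2, M3, M4} \<Longrightarrow> pos_meas_Rplus M"
      "\<And>M. M \<in> {M1, M2, M3, M4} \<Longrightarrow> absolutely_continuous lborel M"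
    using assms unfolding LL1_def by (elim laplace_classE) (rule that)
  have "(laplace_pos M \<longlongrightarrow> 0) (at_infinity_within Cplus_cl)" if M_in: "M \<in> {M1, M2, M3, M4}" for M
  proof -
    obtain u where u: "integrable lborel u" "\<And>t. u t \<ge> 0" "M = density lborel (\<lambda>t. ennreal (u t))"
      using pos_meas_Rplus_abs_continuousE[OF M(1)[OF M_in] M(2)[OF M_in]] by blast
    have "laplace_pos M = laplace_fun (\<lambda>t. of_real (u t))"
      using M(1)[OF M_in] u borel_measurable_integrable[OF u(1)]
      by (intro ext) (simp add: laplace_pos_density)
    then show ?thesis using laplace_fun_Riemann_Lebesgue[OF integrable_of_real[OF u(1)]] by simp
  qed
  then have "(h \<longlongrightarrow> jordan_sum (\<lambda>_. 0) M1 M2 M3 M4) (at_infinity_within Cplus_cl)"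
    unfolding h by (intro tendsto_jordan_sum)
  then show ?thesis by (simp add: jordan_sum_def)
qed

definition pos_part_measure :: "(real \<Rightarrow> real) \<Rightarrow> real measure" where
  "pos_part_measure v = density lborel (\<lambda>t. ennreal (indicator {0..} t * max 0 (v t)))"

lemma pos_part_measure:
  assumes v: "integrable lborel v"
  shows "pos_meas_Rplus (pos_part_measure v)" "absolutely_continuous lborel (pos_part_measure v)"
    "laplace_pos (pos_part_measure v) z = laplace_fun (\<lambda>t. of_real (max 0 (v t))) z"
proof -
  have [measurable]: "v \<in> borel_measurable borel" using borel_measurable_integrable[OF v] by simp
  have "integrable lborel (\<lambda>t. indicator {0..} t * max 0 (v t))"
    by (rule Bochner_Integration.integrable_bound[OF v]) (auto simp: indicator_def)
  then show pos_meas: "pos_meas_Rplus (pos_part_measure v)"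
    unfolding pos_part_measure_def by (intro pos_meas_Rplus_density) auto
  show "absolutely_continuous lborel (pos_part_measure v)"
    unfolding pos_part_measure_def by (intro absolutely_continuousI_density) measurable
  have "laplace_pos (pos_part_measure v) z
      = laplace_fun (\<lambda>t. of_real (indicator {0..} t * max 0 (v t))) z"
    using pos_meas unfolding pos_part_measure_def by (intro laplace_pos_density) auto
  also have "\<dots> = laplace_fun (\<lambda>t. of_real (max 0 (v t))) z"
    unfolding laplace_fun_def by (intro set_lebesgue_integral_cong) auto
  finally show "laplace_pos (pos_part_measure v) z = laplace_fun (\<lambda>t. of_real (max 0 (v t))) z" .
qed

lemma laplace_fun_in_LL1:
  assumes u: "integrable lborel u"
  shows "\<exists>h\<in>LL1. \<forall>z\<in>Cplus. h z = laplace_fun u z"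
proof -
  define p where "p v t = complex_of_real (max 0 (v t))" for v :: "real \<Rightarrow> real" and t
  let ?v1 = "\<lambda>t. Re (u t)" and ?v2 = "\<lambda>t. - Re (u t)" and ?v3 = "\<lambda>t. Im (u t)"
    and ?v4 = "\<lambda>t. - Im (u t)"
  let ?M = pos_part_measure
  define h where "h z = jordan_sum (\<lambda>M. laplace_pos M z) (?M ?v1) (?M ?v2) (?M ?v3) (?M ?v4)" for z
  have v: "integrable lborel ?v1" "integrable lborel ?v2" "integrable lborel ?v3"
    "integrable lborel ?v4"
    using u by auto
  have "h \<in> LL1"
    unfolding h_def[abs_def] LL1_def using pos_part_measure[OF v(1)] pos_part_measure[OF v(2)]
      pos_part_measure[OF v(3)] pos_part_measure[OF v(4)] by (intro laplace_classI) auto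
  moreover have "h z = laplace_fun u z" if "z \<in> Cplus" for z
  proof -
    have p: "integrable lborel (p v)" if "integrable lborel v" for v
      unfolding p_def[abs_def] using that by (intro integrable_of_real integrable_max) auto
    have "u = (\<lambda>t. p ?v1 t - p ?v2 t + \<i> * (p ?v3 t - p ?v4 t))"
      by (auto simp: p_def fun_eq_iff complex_eq_iff max_def)
    then have "laplace_fun u z = laplace_fun (\<lambda>t. p ?v1 t - p ?v2 t + \<i> * (p ?v3 t - p ?v4 t)) z"
      by simp
    also have "\<dots> = jordan_sum (\<lambda>v. laplace_fun (p v) z) ?v1 ?v2 ?v3 ?v4"
      using that p[OF v(1)] p[OF v(2)] p[OF v(3)] p[OF v(4)]
      by (simp add: jordan_sum_def laplace_fun_add laplace_fun_diff laplace_fun_cmult Cplus_def)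
    also have "\<dots> = h z"
      using v by (simp add: h_def jordan_sum_def pos_part_measure(3) p_def[abs_def])
    finally show ?thesis ..
  qed
  ultimately show ?thesis by blast
qed

section \<open>Polynomials in the resolvent\<close>

definition resolvent_poly :: "complex poly \<Rightarrow> complex \<Rightarrow> complex" where
  "resolvent_poly Q z = poly Q (1 / (1 + z)) / (1 + z)"

lemma one_plus_Cplus_cl_nonzero: "z \<in> Cplus_cl \<Longrightarrow> 1 + z \<noteq> 0"
  by (auto simp: Cplus_cl_def complex_eq_iff)

lemma resolvent_poly_eq_sum: "resolvent_poly Q z = (\<Sum>k\<le>degree Q. coeff Q k * (1 / (1 + z) ^ Suc k))"
  by (simp add: resolvent_poly_def poly_altdef sum_divide_distrib power_divide mult.commute)

lemma set_integral_exp_atLeast_0: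
  assumes s: "Re s > 0" and int: "set_integrable lborel {0..} (laplace_kernel s)"
  shows "(LINT t:{0..}|lborel. laplace_kernel s t) = 1 / s"
proof (rule tendsto_unique[OF trivial_limit_at_top_linorder])
  show "((\<lambda>b. LINT t:{0..b}|lborel. laplace_kernel s t)
      \<longlongrightarrow> (LINT t:{0..}|lborel. laplace_kernel s t)) at_top"
    using int by (intro tendsto_set_lebesgue_integral_at_top) auto
  have "s \<noteq> 0" using s by auto
  then have "((\<lambda>b. (1 - laplace_kernel s b) / s) \<longlongrightarrow> (1 - 0) / s) at_top"
    by (intro tendsto_intros laplace_kernel_tendsto_0 s)
  moreover have
    "\<forall>\<^sub>F b in at_top. (1 - laplace_kernel s b) / s = (LINT t:{0..b}|lborel. laplace_kernel s t)"
    using eventually_ge_at_top[of 0]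
    by eventually_elim (simp add: set_integral_exp_Icc[OF \<open>s \<noteq> 0\<close>])
  ultimately show "((\<lambda>b. LINT t:{0..b}|lborel. laplace_kernel s t) \<longlongrightarrow> 1 / s) at_top"
    by (simp add: Lim_transform_eventually)
qed

lemma laplace_fun_erlang_0:
  assumes z: "z \<in> Cplus"
  shows "laplace_fun (\<lambda>t. of_real (erlang_density 0 1 t)) z = 1 / (1 + z)"
proof -
  let ?u = "\<lambda>t. complex_of_real (erlang_density 0 1 t)"
  have eq: "?u t * laplace_kernel z t = laplace_kernel (1 + z) t" if "t \<in> {0..}" for t
    using that by (simp add: erlang_density_def algebra_simps flip: exp_of_real exp_add)
  have "set_integrable lborel {0..} (\<lambda>t. ?u t * laplace_kernel z t)"
    using z
    by (intro set_integrable_laplace_fun_half_plane integrable_of_real integrable_erlang_density)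
      (auto simp: Cplus_def)
  then have "set_integrable lborel {0..} (laplace_kernel (1 + z))"
    by (rule set_integrable_cong[THEN iffD1, OF refl refl eq, rotated])
  then have "(LINT t:{0..}|lborel. laplace_kernel (1 + z) t) = 1 / (1 + z)"
    using z by (intro set_integral_exp_atLeast_0) (simp add: Cplus_def)
  moreover have "laplace_fun ?u z = (LINT t:{0..}|lborel. laplace_kernel (1 + z) t)"
    unfolding laplace_fun_def using eq by (intro set_lebesgue_integral_cong) auto
  ultimately show ?thesis by simp
qed

text \<open>Multiplying \<open>u\<close> by \<open>- t\<close> differentiates its Laplace transform.\<close>

lemma laplace_fun_erlang:
  assumes "z \<in> Cplus"
  shows "laplace_fun (\<lambda>t. of_real (erlang_density k 1 t)) z = 1 / (1 + z) ^ Suc k"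
  using assms
proof (induction k arbitrary: z)
  case 0
  then show ?case by (simp add: laplace_fun_erlang_0)
next
  case (Suc k)
  let ?u = "\<lambda>k t. complex_of_real (erlang_density k 1 t)"
  have nonzero: "1 + z \<noteq> 0" using Suc.prems Cplus_subset_Cplus_cl
    by (intro one_plus_Cplus_cl_nonzero) auto
  have "(laplace_fun (?u k) has_field_derivative laplace_fun (\<lambda>t. - of_real t * ?u k t) z) (at z)"
    by (rule laplace_fun_has_field_derivative[where S = Cplus and C = 1])
      (use Suc.prems open_Cplus in \<open>auto simp: Cplus_def integrable_erlang_density intro!:
        integrable_of_real norm_laplace_kernel_le_1\<close>)
  moreover have
    "(laplace_fun (?u k) has_field_derivative - of_nat (Suc k) / (1 + z) ^ Suc (Suc k)) (at z)"
  proof (rule has_field_derivative_transform_within_open)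
    have "((\<lambda>z. inverse (1 + z)) has_field_derivative - (inverse (1 + z) * inverse (1 + z))) (at z)"
      using nonzero by (auto intro!: derivative_eq_intros simp: divide_simps)
    from DERIV_power[OF this, of "Suc k"]
    show "((\<lambda>z. 1 / (1 + z) ^ Suc k)
        has_field_derivative - of_nat (Suc k) / (1 + z) ^ Suc (Suc k)) (at z)"
      by (simp add: divide_inverse power_inverse mult_ac del: of_nat_Suc)
  qed (use Suc.IH Suc.prems open_Cplus in auto)
  ultimately have
    "laplace_fun (\<lambda>t. - of_real t * ?u k t) z = - of_nat (Suc k) / (1 + z) ^ Suc (Suc k)"
    by (rule DERIV_unique)
  moreover have "- of_real t * ?u k t = - of_nat (Suc k) * ?u (Suc k) t" for t
  proof -
    have "t * erlang_density k 1 t = real (Suc k) * erlang_density (Suc k) 1 t"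
      by (simp add: erlang_density_def)
    from arg_cong[OF this, of complex_of_real] show ?thesis by (simp del: of_nat_Suc)
  qed
  ultimately have
    "- of_nat (Suc k) * laplace_fun (?u (Suc k)) z = - of_nat (Suc k) * (1 / (1 + z) ^ Suc (Suc k))"
    by (simp only: laplace_fun_cmult) simp
  then show ?case by (subst (asm) mult_left_cancel) (simp_all del: of_nat_Suc power_Suc)
qed

definition resolvent_poly_density :: "complex poly \<Rightarrow> real \<Rightarrow> complex" where
  "resolvent_poly_density Q t = (\<Sum>k\<le>degree Q. coeff Q k * of_real (erlang_density k 1 t))"

lemma integrable_resolvent_poly_density: "integrable lborel (resolvent_poly_density Q)"
  unfolding resolvent_poly_density_def[abs_def]
  by (intro Bochner_Integration.integrable_sum integrable_mult_right integrable_of_real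
    integrable_erlang_density) simp

lemma laplace_fun_resolvent_poly_density:
  assumes z: "z \<in> Cplus"
  shows "laplace_fun (resolvent_poly_density Q) z = resolvent_poly Q z"
proof -
  have "laplace_fun (resolvent_poly_density Q) z
      = (\<Sum>k\<le>degree Q. laplace_fun (\<lambda>t. coeff Q k * of_real (erlang_density k 1 t)) z)"
    unfolding resolvent_poly_density_def[abs_def] using z
    by (intro laplace_fun_sum integrable_mult_right integrable_of_real integrable_erlang_density)
      (auto simp: Cplus_def)
  also have "\<dots> = resolvent_poly Q z"
    by (simp only: laplace_fun_cmult laplace_fun_erlang[OF z] resolvent_poly_eq_sum)
  finally show ?thesis .
qed

lemma resolvent_poly_in_LL1: "\<exists>h\<in>LL1. \<forall>z\<in>Cplus. h z = resolvent_poly Q z"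
  using laplace_fun_in_LL1[OF integrable_resolvent_poly_density[of Q]]
  by (simp add: laplace_fun_resolvent_poly_density)

section \<open>Rational functions\<close>

lemma R0I:
  assumes "degree p < degree q" "\<And>z. z \<in> Cplus_cl \<Longrightarrow> poly q z \<noteq> 0" "\<And>z. f z = poly p z / poly q z"
  shows "f \<in> R0"
  using assms unfolding R0_def by blast

lemma R0E:
  assumes "f \<in> R0"
  obtains p q
    where "f = (\<lambda>z. poly p z / poly q z)" "degree p < degree q" "\<And>z. z \<in> Cplus_cl \<Longrightarrow> poly q z \<noteq> 0"
  using assms unfolding R0_def by blast

lemma R0_holomorphic:
  assumes "f \<in> R0"
  shows "f holomorphic_on Cplus"
  using assms Cplus_subset_Cplus_cl by (elim R0E) (auto intro!: holomorphic_intros)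

lemma R0_tendsto_0:
  assumes "f \<in> R0"
  shows "(f \<longlongrightarrow> 0) (at_infinity_within Cplus)"
proof (rule tendsto_mono[OF inf_le1])
  show "(f \<longlongrightarrow> 0) at_infinity"
    using assms by (elim R0E) (simp add: poly_divide_tendsto_0_at_infinity)
qed

lemma R0_shift:
  assumes "f \<in> R0" "a \<ge> 0"
  shows "(\<lambda>z. f (z + of_real a)) \<in> R0"
proof -
  obtain p q
    where f: "f = (\<lambda>z. poly p z / poly q z)" "degree p < degree q" "\<And>z. z \<in> Cplus_cl \<Longrightarrow> poly q z \<noteq> 0"
    using assms(1) by (rule R0E) (rule that)
  show ?thesis
    by (rule R0I[of "pcompose p [:of_real a, 1:]" "pcompose q [:of_real a, 1:]"])
      (use f assms(2) in \<open>auto simp: poly_pcompose degree_pcompose add.commute Cplus_cl_def\<close>)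
qed

text \<open>The quotient representing \<open>f - g\<close> need not agree with it at the poles, where division by
  zero yields 0.\<close>

lemma R0_diff:
  assumes "f \<in> R0" "g \<in> R0"
  shows "\<exists>h\<in>R0. \<forall>z\<in>Cplus. h z = f z - g z"
proof -
  obtain p q
    where f: "f = (\<lambda>z. poly p z / poly q z)" "degree p < degree q" "\<And>z. z \<in> Cplus_cl \<Longrightarrow> poly q z \<noteq> 0"
    using assms(1) by (rule R0E) (rule that)
  obtain r s
    where g: "g = (\<lambda>z. poly r z / poly s z)" "degree r < degree s" "\<And>z. z \<in> Cplus_cl \<Longrightarrow> poly s z \<noteq> 0"
    using assms(2) by (rule R0E) (rule that)
  show ?thesis
  proof (intro bexI ballI)
    show "(\<lambda>z. poly (p * s - r * q) z / poly (q * s) z) \<in> R0"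
    proof (rule R0I)
      have "degree (p * s) < degree q + degree s" "degree (r * q) < degree q + degree s"
        using f(2) g(2) degree_mult_le[of p s] degree_mult_le[of r q] by auto
      then have "degree (p * s - r * q) < degree q + degree s" by (rule degree_diff_less)
      moreover have "q \<noteq> 0" "s \<noteq> 0" using f(2) g(2) by auto
      ultimately show "degree (p * s - r * q) < degree (q * s)" by (simp add: degree_mult_eq)
    qed (use f(3) g(3) in auto)
    fix z assume "z \<in> Cplus"
    then show "poly (p * s - r * q) z / poly (q * s) z = f z - g z"
      using f(3)[of z] g(3)[of z] Cplus_subset_Cplus_cl by (auto simp: f(1) g(1) field_simps)
  qed
qed

lemma resolvent_poly_in_R0: "resolvent_poly Q \<in> R0"
proof (rule R0I)
  let ?p = "pcompose (reflect_poly Q) [:1, 1:]" and ?q = "[:1, 1:] ^ Suc (degree Q) :: complex poly"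
  have "degree ?q = Suc (degree Q)" by (subst degree_power_eq) auto
  moreover have "degree ?p \<le> degree Q" by (simp add: degree_pcompose degree_reflect_poly_le)
  ultimately show "degree ?p < degree ?q" by simp
  show "poly ?q z \<noteq> 0" if "z \<in> Cplus_cl" for z
    using one_plus_Cplus_cl_nonzero[OF that] by (simp del: power_Suc)
  show "resolvent_poly Q z = poly ?p z / poly ?q z" for z
  proof (cases "1 + z = 0")
    case False
    then have "poly ?p z = (1 + z) ^ degree Q * poly Q (1 / (1 + z))"
      by (simp add: poly_pcompose poly_reflect_poly_nz inverse_eq_divide)
    moreover have "poly ?q z = (1 + z) ^ degree Q * (1 + z)"
      by (simp add: algebra_simps)
    moreover have "(1 + z) ^ degree Q \<noteq> 0" using False by simp
    ultimately show ?thesis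
      by (simp only: resolvent_poly_def mult_divide_mult_cancel_left not_False_eq_True)
  next
    case True
    then have "z = - 1" by (simp add: add_eq_0_iff)
    then show ?thesis by (simp add: resolvent_poly_def)
  qed
qed

section \<open>Closure under shifts\<close>

lemma of_real_at_infinity_Cplus: "filterlim complex_of_real (at_infinity_within Cplus) at_top"
proof -
  have "\<forall>\<^sub>F x in at_top. complex_of_real x \<in> Cplus"
    using eventually_gt_at_top[of 0] by eventually_elim (simp add: Cplus_def)
  then show ?thesis
    unfolding filterlim_inf filterlim_principal by (intro conjI filterlim_of_real_at_infinity)
qed

lemma closure_B_eq_closure_sup_of_tendsto_0:
  assumes hol: "\<And>h. h \<in> Y \<Longrightarrow> h holomorphic_on Cplus"
    and lim: "\<And>h. h \<in> Y \<Longrightarrow> (h \<longlongrightarrow> 0) (at_infinity_within Cplus)"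
    and shift: "\<And>h a. h \<in> Y \<Longrightarrow> a \<ge> 0 \<Longrightarrow> (\<lambda>z. h (z + of_real a)) \<in> Y"
    and diff: "\<And>f g. f \<in> Y \<Longrightarrow> g \<in> Y \<Longrightarrow> \<exists>h\<in>Y. \<forall>z\<in>Cplus. h z = f z - g z"
  shows "closure_B Y = closure_sup Y"
proof (rule closure_B_eq_closure_sup[OF hol])
  fix h \<delta> n assume h: "h \<in> Y" and "0 < \<delta>" "\<delta> < (n :: real)"
  then have "(\<lambda>z. h (z + of_real \<delta>)) \<in> Y" "(\<lambda>z. h (z + of_real n)) \<in> Y" by (auto intro: shift)
  from diff[OF this] obtain h' where "h' \<in> Y" "\<And>z. z \<in> Cplus \<Longrightarrow> h' z = shift_diff \<delta> n h z + 0"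
    by (auto simp: shift_diff_def)
  moreover have "((\<lambda>x. h (of_real x)) \<longlongrightarrow> 0) at_top"
    by (rule filterlim_compose[OF lim[OF h] of_real_at_infinity_Cplus])
  ultimately show
    "\<exists>h'\<in>Y. \<exists>c. ((\<lambda>x. h (of_real x)) \<longlongrightarrow> c) at_top \<and> (\<forall>z\<in>Cplus. h' z = shift_diff \<delta> n h z + c)"
    by blast
qed

lemma R0_closures_eq: "closure_B R0 = closure_sup R0"
  by (rule closure_B_eq_closure_sup_of_tendsto_0)
    (fact R0_holomorphic R0_tendsto_0 R0_shift R0_diff)+

section \<open>Entire functions of exponential type\<close>

lemma C0_clE:
  assumes "C0_cl f"
  obtains g
    where "continuous_on Cplus_cl g" "\<forall>z\<in>Cplus. g z = f z" "(g \<longlongrightarrow> 0) (at_infinity_within Cplus_cl)"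
  using assms unfolding C0_cl_def by blast

lemma C0_cl_tendsto_0:
  assumes "C0_cl f"
  shows "(f \<longlongrightarrow> 0) (at_infinity_within Cplus)"
proof -
  obtain g where g: "\<forall>z\<in>Cplus. g z = f z" "(g \<longlongrightarrow> 0) (at_infinity_within Cplus_cl)"
    using assms by (rule C0_clE)
  have "(g \<longlongrightarrow> 0) (at_infinity_within Cplus)"
    using g(2)
    by (rule tendsto_mono[rotated]) (intro inf_mono order_refl, simp add: Cplus_subset_Cplus_cl)
  moreover have "\<forall>\<^sub>F z in at_infinity_within Cplus. g z = f z"
    using g(1) by (simp add: eventually_inf_principal)
  ultimately show ?thesis by (rule Lim_transform_eventually)
qed

lemma C0_cl_diff:
  assumes "C0_cl f" "C0_cl g"
  shows "C0_cl (\<lambda>z. f z - g z)"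
proof -
  obtain F
    where F: "continuous_on Cplus_cl F" "\<forall>z\<in>Cplus. F z = f z"
      "(F \<longlongrightarrow> 0) (at_infinity_within Cplus_cl)"
    using assms(1) by (rule C0_clE)
  obtain G
    where G: "continuous_on Cplus_cl G" "\<forall>z\<in>Cplus. G z = g z"
      "(G \<longlongrightarrow> 0) (at_infinity_within Cplus_cl)"
    using assms(2) by (rule C0_clE)
  show ?thesis unfolding C0_cl_def
    using F G tendsto_diff[OF F(3) G(3)]
    by (intro exI[of _ "\<lambda>z. F z - G z"]) (auto intro: continuous_on_diff)
qed

lemma C0_cl_shift:
  assumes "C0_cl f" and a: "a \<ge> 0"
  shows "C0_cl (\<lambda>z. f (z + of_real a))"
proof -
  obtain F
    where F: "continuous_on Cplus_cl F" "\<forall>z\<in>Cplus. F z = f z"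
      "(F \<longlongrightarrow> 0) (at_infinity_within Cplus_cl)"
    using assms(1) by (rule C0_clE)
  have "filterlim (\<lambda>z. z + complex_of_real a) at_infinity at_infinity"
    by (rule tendsto_add_filterlim_at_infinity'[OF filterlim_ident tendsto_const])
  then have
    "filterlim (\<lambda>z. z
        + complex_of_real a) (at_infinity_within Cplus_cl) (at_infinity_within Cplus_cl)"
    unfolding filterlim_inf filterlim_principal
    using a by (auto intro: filterlim_mono simp: eventually_inf_principal Cplus_cl_def)
  then have "((\<lambda>z. F (z + of_real a)) \<longlongrightarrow> 0) (at_infinity_within Cplus_cl)"
    by (rule filterlim_compose[OF F(3)])
  moreover have "continuous_on Cplus_cl (\<lambda>z. F (z + of_real a))"
    using a by (intro continuous_on_compose2[OF F(1)] continuous_intros) (auto simp: Cplus_cl_def)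
  ultimately show ?thesis unfolding C0_cl_def
    using F(2) a Cplus_add_of_real by (intro exI[of _ "\<lambda>z. F (z + of_real a)"]) auto
qed

lemma J0I:
  assumes "f holomorphic_on UNIV" "\<And>z. cmod (f z) \<le> A * exp (B * cmod z)" "bounded (f ` Cplus)"
      "C0_cl f"
  shows "f \<in> J0"
  unfolding J0_def using assms by auto

lemma J0E:
  assumes "f \<in> J0"
  obtains A B where "f holomorphic_on UNIV" "A \<ge> 0" "B \<ge> 0" "\<And>z. cmod (f z) \<le> A * exp (B * cmod z)"
    "bounded (f ` Cplus)" "C0_cl f"
proof -
  obtain A B
    where f: "f holomorphic_on UNIV" "\<And>z. cmod (f z) \<le> A * exp (B * cmod z)" "bounded (f ` Cplus)"
      "C0_cl f"
    using assms unfolding J0_def by blast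
  have "cmod (f z) \<le> \<bar>A\<bar> * exp (\<bar>B\<bar> * cmod z)" for z
    by (rule order_trans[OF f(2)], rule mult_mono) (auto intro!: mult_right_mono)
  then show ?thesis using f by (intro that[of "\<bar>A\<bar>" "\<bar>B\<bar>"]) auto
qed

lemma J0_diff:
  assumes "f \<in> J0" "g \<in> J0"
  shows "(\<lambda>z. f z - g z) \<in> J0"
proof -
  obtain A B
    where f: "f holomorphic_on UNIV" "A \<ge> 0" "B \<ge> 0" "\<And>z. cmod (f z) \<le> A * exp (B * cmod z)"
    "bounded (f ` Cplus)" "C0_cl f" using J0E[OF assms(1)] by blast
  obtain A' B'
    where g: "g holomorphic_on UNIV" "A' \<ge> 0" "B' \<ge> 0" "\<And>z. cmod (g z) \<le> A' * exp (B' * cmod z)"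
    "bounded (g ` Cplus)" "C0_cl g" using J0E[OF assms(2)] by blast
  show ?thesis
  proof (rule J0I)
    fix z
    have "A * exp (B * cmod z) \<le> A * exp ((B + B') * cmod z)"
      "A' * exp (B' * cmod z) \<le> A' * exp ((B + B') * cmod z)"
      using f g by (auto intro!: mult_left_mono mult_right_mono)
    then show "cmod (f z - g z) \<le> (A + A') * exp ((B + B') * cmod z)"
      using norm_triangle_ineq4[of "f z" "g z"] f(4)[of z] g(4)[of z] by (simp add: distrib_right)
  qed (use f g in \<open>auto intro: holomorphic_on_diff C0_cl_diff bounded_minus_comp\<close>)
qed

lemma J0_shift:
  assumes "f \<in> J0" and a: "a \<ge> 0"
  shows "(\<lambda>z. f (z + of_real a)) \<in> J0"
proof -
  obtain A B
    where f: "f holomorphic_on UNIV" "A \<ge> 0" "B \<ge> 0" "\<And>z. cmod (f z) \<le> A * exp (B * cmod z)"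
    "bounded (f ` Cplus)" "C0_cl f" using J0E[OF assms(1)] by blast
  show ?thesis
  proof (rule J0I)
    have "(f \<circ> (\<lambda>z. z + of_real a)) holomorphic_on UNIV"
      by (intro holomorphic_on_compose_gen[OF _ f(1)] holomorphic_intros) auto
    then show "(\<lambda>z. f (z + of_real a)) holomorphic_on UNIV" by (simp add: o_def)
    show "bounded ((\<lambda>z. f (z + of_real a)) ` Cplus)"
      by (rule bounded_subset[OF f(5)]) (use a Cplus_add_of_real in auto)
    fix z
    have "B * cmod (z + of_real a) \<le> B * (a + cmod z)"
      using norm_triangle_ineq[of z "of_real a"] a f(3) by (intro mult_left_mono) auto
    then have "A * exp (B * cmod (z + of_real a)) \<le> A * exp (B * (a + cmod z))" using f(2)
      by (intro mult_left_mono) auto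
    then show "cmod (f (z + of_real a)) \<le> A * exp (B * a) * exp (B * cmod z)"
      using f(4)[of "z + of_real a"] by (simp add: distrib_left exp_add)
  qed (use f a in \<open>auto intro: C0_cl_shift\<close>)
qed

lemma J0_tendsto_0: "f \<in> J0 \<Longrightarrow> (f \<longlongrightarrow> 0) (at_infinity_within Cplus)"
  by (auto simp: J0_def intro: C0_cl_tendsto_0)

lemma J0_closures_eq: "closure_B J0 = closure_sup J0"
proof (rule closure_B_eq_closure_sup_of_tendsto_0)
  show "h holomorphic_on Cplus" if "h \<in> J0" for h
    using that by (auto simp: J0_def intro: holomorphic_on_subset)
  show "\<exists>h\<in>J0. \<forall>z\<in>Cplus. h z = f z - g z" if "f \<in> J0" "g \<in> J0" for f g
    using J0_diff[OF that] by (rule bexI[rotated]) simp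
qed (fact J0_tendsto_0 J0_shift)+

lemma laplace_fun_compact_support_in_J0:
  assumes u: "integrable lborel u" and K: "K \<ge> 0" "\<And>t. t > K \<Longrightarrow> u t = 0"
  shows "laplace_fun u \<in> J0"
proof -
  have kernel: "cmod (laplace_kernel z t) \<le> exp (K * cmod z)" if "t \<ge> 0" "u t \<noteq> 0" for z t
  proof -
    have "t \<le> K" using K(2)[of t] that by force
    have "- (Re z * t) \<le> cmod z * t"
      using abs_Re_le_cmod[of z] mult_right_mono[of "- Re z" "cmod z" t] that by simp
    also have "\<dots> \<le> cmod z * K" using \<open>t \<le> K\<close> by (intro mult_left_mono) auto
    finally show ?thesis by (simp add: norm_laplace_kernel mult.commute)
  qed
  have hol: "laplace_fun u holomorphic_on UNIV"
    unfolding holomorphic_on_open[OF open_UNIV]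
  proof (intro ballI exI)
    fix z :: complex
    let ?C = "exp (K * (cmod z + 1))"
    have "cmod (laplace_kernel w t) \<le> ?C" if "w \<in> ball 0 (cmod z + 1)" "t \<ge> 0" "u t \<noteq> 0" for w t
    proof -
      have "exp (K * cmod w) \<le> ?C" using that(1) K(1) by (auto intro!: mult_left_mono)
      then show ?thesis using kernel[OF that(2,3)] order_trans by blast
    qed
    then show "(laplace_fun u has_field_derivative laplace_fun (\<lambda>t. - of_real t * u t) z) (at z)"
      by (intro laplace_fun_has_field_derivative[OF u, where S = "ball 0 (cmod z + 1)" and C = ?C])
        auto
  qed
  show ?thesis
  proof (rule J0I[OF hol])
    show "cmod (laplace_fun u z) \<le> (LINT t|lborel. cmod (u t)) * exp (K * cmod z)" for z
      using norm_laplace_fun_le[OF u _ kernel] by (simp add: mult.commute)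
    have "cmod (laplace_fun u z) \<le> (LINT t|lborel. cmod (u t))" if "z \<in> Cplus" for z
      using that by (intro norm_laplace_fun_le_half_plane u) (auto simp: Cplus_def)
    then show "bounded (laplace_fun u ` Cplus)" by (auto simp: bounded_iff)
    show "C0_cl (laplace_fun u)"
      unfolding C0_cl_def using laplace_fun_Riemann_Lebesgue[OF u]
        holomorphic_on_imp_continuous_on[OF hol]
      by (intro exI[of _ "laplace_fun u"]) (auto intro: continuous_on_subset)
  qed
qed

lemma laplace_fun_J0_approx:
  assumes u: "integrable lborel u" and e: "e > 0"
  shows "\<exists>h\<in>J0. \<forall>z\<in>Cplus. cmod (h z - laplace_fun u z) < e"
proof -
  have [measurable]: "u \<in> borel_measurable borel" using borel_measurable_integrable[OF u] by simp
  define s where "s n t = indicator {..real n} t *\<^sub>R u t" for n t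
  have int: "integrable lborel (s n)" for n
    unfolding s_def by (rule Bochner_Integration.integrable_bound[OF u]) (auto simp: indicator_def)
  have "(\<lambda>n. s n t) \<longlonglongrightarrow> u t" for t
  proof (rule tendsto_eventually)
    show "\<forall>\<^sub>F n in sequentially. s n t = u t"
      using eventually_ge_at_top[of "nat \<lceil>t\<rceil>"] by eventually_elim (auto simp: s_def indicator_def)
  qed
  then have "(\<lambda>n. LINT t|lborel. cmod (s n t - u t)) \<longlonglongrightarrow> 0"
    using u int by (intro integral_norm_diff_tendsto_0[where w = "\<lambda>t. cmod (u t)"])
      (auto simp: s_def indicator_def)
  from uniform_limitD[OF uniform_limit_laplace_fun[OF u int this] e]
  obtain n where n: "\<forall>z\<in>Cplus_cl. dist (laplace_fun (s n) z) (laplace_fun u z) < e"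
    by (auto dest: eventually_happens)
  moreover have "laplace_fun (s n) \<in> J0"
    by (rule laplace_fun_compact_support_in_J0[OF int, of "real n"]) (auto simp: s_def)
  ultimately show ?thesis using Cplus_subset_Cplus_cl by (auto simp: dist_norm)
qed

section \<open>Density of polynomials in the resolvent\<close>

definition cayley :: "complex \<Rightarrow> complex" where
  "cayley w = (1 - w) / (1 + w)"

lemma one_plus_nonzero: "w \<noteq> - 1 \<Longrightarrow> 1 + w \<noteq> (0::complex)"
  by (simp add: add_eq_0_iff)

lemma cayley_involution:
  assumes "w \<noteq> - 1"
  shows "cayley (cayley w) = w"
proof -
  have "1 + w \<noteq> 0" using assms by (rule one_plus_nonzero)
  then have "1 - cayley w = 2 * w / (1 + w)" "1 + cayley w = 2 / (1 + w)"
    by (simp_all add: cayley_def field_simps)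
  then show ?thesis using \<open>1 + w \<noteq> 0\<close> by (simp add: cayley_def[of "cayley w"])
qed

lemma cayley_mem_half_plane:
  assumes "w \<noteq> - 1"
  shows "cayley w \<in> Cplus_cl \<longleftrightarrow> cmod w \<le> 1" "cayley w \<in> Cplus \<longleftrightarrow> cmod w < 1"
proof -
  have "Re ((1 - w) * cnj (1 + w)) = 1 - (cmod w)\<^sup>2"
    unfolding cmod_power2 by (simp add: algebra_simps power2_eq_square)
  then show "cayley w \<in> Cplus_cl \<longleftrightarrow> cmod w \<le> 1" "cayley w \<in> Cplus \<longleftrightarrow> cmod w < 1"
    unfolding cayley_def Cplus_def Cplus_cl_def mem_Collect_eq Re_complex_div_ge_0
      Re_complex_div_gt_0
    by (simp_all add: power_le_one_iff power_less_one_iff abs_square_le_1 abs_square_less_1)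
qed

lemma cayley_in_ball: "z \<in> Cplus \<Longrightarrow> cayley z \<in> ball 0 1" "z \<in> Cplus \<Longrightarrow> cayley z \<noteq> - 1"
proof -
  assume z: "z \<in> Cplus"
  then have nonzero: "1 + z \<noteq> 0" using one_plus_Cplus_cl_nonzero Cplus_subset_Cplus_cl by auto
  then show "cayley z \<noteq> - 1" by (auto simp: cayley_def field_simps)
  moreover have "z \<noteq> - 1" using nonzero by auto
  ultimately show "cayley z \<in> ball 0 1"
    using cayley_mem_half_plane(2)[of "cayley z"] cayley_involution z by simp
qed

lemma cayley_holomorphic: "cayley holomorphic_on - {- 1}"
  unfolding cayley_def[abs_def] by (intro holomorphic_intros) (simp add: one_plus_nonzero)

lemma filterlim_cayley: "filterlim cayley (at_infinity_within Cplus_cl) (at (- 1) within cball 0 1)"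
proof -
  let ?A = "at (- 1) within cball (0::complex) 1"
  have "((\<lambda>w. 1 + w) \<longlongrightarrow> 1 + (- 1 :: complex)) ?A" by (intro tendsto_intros)
  then have "filterlim (\<lambda>w::complex. 1 + w) (at 0) ?A"
    by (auto simp: filterlim_at eventually_at_filter one_plus_nonzero)
  then have "filterlim cayley at_infinity ?A"
    unfolding cayley_def[abs_def]
    by (intro filterlim_divide_at_infinity[of _ "1 - (- 1)"] tendsto_intros) auto
  moreover have "\<forall>\<^sub>F w in ?A. cayley w \<in> Cplus_cl"
    by (auto simp: eventually_at_filter cayley_mem_half_plane intro!: always_eventually)
  ultimately show ?thesis by (simp add: filterlim_inf filterlim_principal)
qed

definition disc_transform :: "(complex \<Rightarrow> complex) \<Rightarrow> complex \<Rightarrow> complex" where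
  "disc_transform g w = (if w = - 1 then 0 else g (cayley w))"

lemma continuous_on_disc_transform:
  assumes g: "continuous_on Cplus_cl g" "(g \<longlongrightarrow> 0) (at_infinity_within Cplus_cl)"
  shows "continuous_on (cball 0 1) (disc_transform g)"
  unfolding continuous_on_eq_continuous_within
proof
  fix w :: complex assume w: "w \<in> cball 0 1"
  show "continuous (at w within cball 0 1) (disc_transform g)"
  proof (cases "w = - 1")
    case False
    have "cayley ` (cball 0 1 - {- 1}) \<subseteq> Cplus_cl"
      using cayley_mem_half_plane(1) by (simp add: image_subset_iff)
    then have "continuous_on (cball 0 1 - {- 1}) (\<lambda>w. g (cayley w))"
      by (intro continuous_on_compose2[OF g(1)
            continuous_on_subset[OF holomorphic_on_imp_continuous_on[OF cayley_holomorphic]]]) auto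
    then have "continuous_on (cball 0 1 - {- 1}) (disc_transform g)"
      by (rule continuous_on_eq) (simp add: disc_transform_def)
    then have "continuous (at w within (cball 0 1 - {- 1})) (disc_transform g)"
      using w False by (simp add: continuous_on_eq_continuous_within)
    moreover have "at w within (cball 0 1 - {- 1}) = at w within cball 0 1"
      using False by (intro at_within_nhd[of _ "- {- 1}"]) auto
    ultimately show ?thesis by (simp add: continuous_within)
  next
    case True
    have "((\<lambda>w. g (cayley w)) \<longlongrightarrow> 0) (at (- 1) within cball 0 1)"
      by (rule filterlim_compose[OF g(2) filterlim_cayley])
    moreover have "\<forall>\<^sub>F w in at (- 1) within cball 0 1. g (cayley w) = disc_transform g w"
      by (auto simp: eventually_at_filter disc_transform_def)
    ultimately have "(disc_transform g \<longlongrightarrow> 0) (at (- 1) within cball 0 1)"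
      by (rule Lim_transform_eventually)
    then show ?thesis using True by (simp add: continuous_within disc_transform_def)
  qed
qed

lemma disc_transform_holomorphic:
  assumes "g holomorphic_on Cplus"
  shows "disc_transform g holomorphic_on ball 0 1"
proof -
  have ball: "w \<noteq> - 1" if "w \<in> ball 0 1" for w :: complex using that by auto
  then have "cayley ` ball 0 1 \<subseteq> Cplus" using cayley_mem_half_plane(2) by auto
  then have "(g \<circ> cayley) holomorphic_on ball 0 1"
    using ball
    by (intro holomorphic_on_compose_gen[OF holomorphic_on_subset[OF cayley_holomorphic] assms])
      auto
  then show ?thesis
    by (rule holomorphic_transform) (simp add: ball disc_transform_def)
qed

text \<open>With \<open>w = cayley z\<close>, a polynomial in \<open>w = 2 / (1 + z) - 1\<close> is a polynomial in \<open>1 / (1 + z)\<close>;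
  its constant term is the value at \<open>w = - 1\<close>, that is, at infinity.\<close>

lemma poly_cayley_eq_resolvent_poly:
  obtains Q where "\<And>z. z \<in> Cplus \<Longrightarrow> poly P (cayley z) - poly P (- 1) = resolvent_poly Q z"
proof -
  define R where "R = pcompose P [:- 1, 2:] - [:poly P (- 1):]"
  have R: "poly R v = poly P (2 * v - 1) - poly P (- 1)" for v
    by (simp add: R_def poly_pcompose mult.commute)
  obtain a Q where Q: "R = pCons a Q" by (rule pCons_cases)
  then have "a = 0" using R[of 0] by simp
  show ?thesis
  proof (rule that[of Q])
    fix z assume "z \<in> Cplus"
    then have "1 + z \<noteq> 0" using one_plus_Cplus_cl_nonzero Cplus_subset_Cplus_cl by auto
    then have "cayley z = 2 * (1 / (1 + z)) - 1" by (simp add: cayley_def field_simps)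
    then have "poly P (cayley z) - poly P (- 1) = poly R (1 / (1 + z))" by (simp only: R)
    then show "poly P (cayley z) - poly P (- 1) = resolvent_poly Q z"
      by (simp add: Q \<open>a = 0\<close> resolvent_poly_def)
  qed
qed

lemma C0_resolvent_poly_approx:
  assumes hol: "f holomorphic_on Cplus" and C0: "C0_cl f" and e: "e > 0"
  obtains Q where "\<And>z. z \<in> Cplus \<Longrightarrow> cmod (f z - resolvent_poly Q z) < e"
proof -
  obtain g
    where g: "continuous_on Cplus_cl g" "\<forall>z\<in>Cplus. g z = f z"
      "(g \<longlongrightarrow> 0) (at_infinity_within Cplus_cl)"
    using C0 by (rule C0_clE)
  have "g holomorphic_on Cplus" using hol by (rule holomorphic_transform) (simp add: g(2))
  then obtain P where P: "\<And>w. w \<in> cball 0 1 \<Longrightarrow> cmod (disc_transform g w - poly P w) < e / 2"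
    using disc_algebra_poly_approx[OF continuous_on_disc_transform[OF g(1,3)]
      disc_transform_holomorphic, of "e / 2"]
      e by auto
  obtain Q where Q: "\<And>z. z \<in> Cplus \<Longrightarrow> poly P (cayley z) - poly P (- 1) = resolvent_poly Q z"
    using poly_cayley_eq_resolvent_poly[of P] by blast
  show ?thesis
  proof (rule that[of Q])
    fix z assume z: "z \<in> Cplus"
    have "z \<noteq> - 1" using z by (auto simp: Cplus_def)
    then have "disc_transform g (cayley z) = f z"
      using cayley_in_ball(2)[OF z] z g(2) by (simp add: disc_transform_def cayley_involution)
    then have "cmod (f z - poly P (cayley z)) < e / 2"
      using P[of "cayley z"] cayley_in_ball(1)[OF z] by simp
    moreover have "cmod (poly P (- 1)) < e / 2" using P[of "- 1"] by (simp add: disc_transform_def)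
    ultimately show "cmod (f z - resolvent_poly Q z) < e"
      using norm_triangle_ineq[of "f z - poly P (cayley z)" "poly P (- 1)"]
      by (simp flip: Q[OF z] add: algebra_simps)
  qed
qed

section \<open>Boundary values of functions in the space B\<close>

lemma dist_less_of_sup_norm_less:
  assumes "sup_norm (\<lambda>z. f z - g z) < ennreal e" "z \<in> Cplus"
  shows "cmod (f z - g z) < e"
  using le_less_trans[OF norm_le_sup_norm[OF assms(2), of "\<lambda>z. f z - g z"] assms(1)]
  by (simp add: ennreal_less_iff)

lemma B_space_uniformly_continuous:
  assumes g: "g \<in> B_space"
  shows "uniformly_continuous_on Cplus g"
proof (rule uniform_limit_uniformly_continuous_on)
  obtain G where G: "\<And>z. z \<in> Cplus \<Longrightarrow> cmod (g z) \<le> G"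
    using B_space_bounded[OF g] unfolding bounded_iff by blast
  have "uniformly_continuous_on Cplus (\<lambda>z. g (z + of_real \<delta>))" if "\<delta> > 0" for \<delta>
  proof -
    have lip: "(2 * G / \<delta>)-lipschitz_on {z. \<delta> \<le> Re z} g"
      by (rule lipschitz_on_half_plane[OF B_spaceD(1)[OF g] G that])
    have "(2 * G / \<delta>)-lipschitz_on Cplus (\<lambda>z. g (z + of_real \<delta>))"
    proof (rule lipschitz_onI)
      show "dist (g (z + of_real \<delta>)) (g (w + of_real \<delta>)) \<le> 2 * G / \<delta> * dist z w"
        if "z \<in> Cplus" "w \<in> Cplus" for z w
        using lipschitz_onD[OF lip, of "z + of_real \<delta>" "w + of_real \<delta>"] that
        by (simp add: Cplus_def)
    qed (rule lipschitz_on_nonneg[OF lip])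
    then show ?thesis by (rule lipschitz_on_uniformly_continuous)
  qed
  then show "\<forall>\<^sub>F \<delta> in at_right 0. uniformly_continuous_on Cplus (\<lambda>z. g (z + of_real \<delta>))"
    using eventually_at_right_less[of "0::real"] by (auto elim: eventually_mono)
  show "uniform_limit Cplus (\<lambda>\<delta> z. g (z + of_real \<delta>)) g (at_right 0)"
  proof (rule uniform_limitI)
    fix e :: real assume "e > 0"
    then have "\<forall>\<^sub>F \<delta> in at_right 0. sup_norm (shift_diff 0 \<delta> g) < ennreal e"
      using sup_norm_shift_diff_tendsto_0[OF g] by (intro order_tendstoD(2)) auto
    then show "\<forall>\<^sub>F \<delta> in at_right 0. \<forall>z\<in>Cplus. dist (g (z + of_real \<delta>)) (g z) < e"
      by eventually_elim
        (auto simp: shift_diff_def[abs_def] dist_norm norm_minus_commute intro: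
          dist_less_of_sup_norm_less)
  qed
qed simp

lemma closure_Cplus: "closure Cplus = Cplus_cl"
  using closure_halfspace_gt[of "1::complex" 0]
  by (simp add: Cplus_def Cplus_cl_def inner_complex_def)

lemma B_space_C0_clI:
  assumes g: "g \<in> B_space" and lim: "(g \<longlongrightarrow> 0) (at_infinity_within Cplus)"
  shows "C0_cl g"
proof -
  obtain G where G: "uniformly_continuous_on (closure Cplus) G" "\<And>z. z \<in> Cplus \<Longrightarrow> g z = G z"
    by (rule uniformly_continuous_on_extension_on_closure[OF B_space_uniformly_continuous[OF g]],
      rule that)
  then have cont: "continuous_on (closure Cplus) G" by (intro uniformly_continuous_imp_continuous)
  have "\<forall>\<^sub>F z in at_infinity_within Cplus. g z = G z" by (simp add: eventually_inf_principal G(2))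
  with lim have "(G \<longlongrightarrow> 0) (at_infinity_within Cplus)" by (rule Lim_transform_eventually)
  with cont have "(G \<longlongrightarrow> 0) (at_infinity_within Cplus_cl)"
    unfolding closure_Cplus[symmetric] by (rule tendsto_0_at_infinity_closure)
  then show ?thesis
    unfolding C0_cl_def using cont G(2) by (auto simp: closure_Cplus)
qed

section \<open>The closures\<close>

lemma closure_sup_subset_C0:
  assumes lim: "\<And>h. h \<in> Y \<Longrightarrow> (h \<longlongrightarrow> 0) (at_infinity_within Cplus)"
  shows "closure_sup Y \<subseteq> {f \<in> B_space. C0_cl f}"
proof (intro subsetI CollectI conjI)
  fix g assume gY: "g \<in> closure_sup Y"
  then show g: "g \<in> B_space" by (simp add: closure_sup_def)
  show "C0_cl g"
  proof (rule B_space_C0_clI[OF g], rule tendstoI)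
    fix e :: real assume "e > 0"
    then obtain h where h: "h \<in> Y" "sup_norm (\<lambda>z. g z - h z) < ennreal (e / 2)"
      using gY unfolding closure_sup_def by (auto dest: spec[of _ "e / 2"])
    have "\<forall>\<^sub>F z in at_infinity_within Cplus. z \<in> Cplus" by (simp add: eventually_inf_principal)
    moreover have "\<forall>\<^sub>F z in at_infinity_within Cplus. dist (h z) 0 < e / 2"
      using tendstoD[OF lim[OF h(1)], of "e / 2"] \<open>e > 0\<close> by simp
    ultimately show "\<forall>\<^sub>F z in at_infinity_within Cplus. dist (g z) 0 < e"
    proof eventually_elim
      case (elim z)
      then show ?case
        using dist_less_of_sup_norm_less[OF h(2)] norm_triangle_sub[of "g z" "h z"]
        by (force simp: dist_norm)
    qed
  qed
qed

lemma C0_subset_closure_sup: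
  assumes approx: "\<And>Q e. e > 0 \<Longrightarrow> \<exists>h\<in>Y. \<forall>z\<in>Cplus. cmod (h z - resolvent_poly Q z) < e"
  shows "{f \<in> B_space. C0_cl f} \<subseteq> closure_sup Y"
proof
  fix g assume "g \<in> {f \<in> B_space. C0_cl f}"
  then have g: "g \<in> B_space" "C0_cl g" by auto
  have "\<exists>h\<in>Y. sup_norm (\<lambda>z. g z - h z) < ennreal e" if "e > 0" for e
  proof -
    obtain Q where Q: "\<And>z. z \<in> Cplus \<Longrightarrow> cmod (g z - resolvent_poly Q z) < e / 4"
      using C0_resolvent_poly_approx[OF B_spaceD(1)[OF g(1)] g(2), of "e / 4"] \<open>e > 0\<close> by auto
    obtain h where h: "h \<in> Y" "\<And>z. z \<in> Cplus \<Longrightarrow> cmod (h z - resolvent_poly Q z) < e / 4"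
      using approx[of "e / 4" Q] \<open>e > 0\<close> by auto
    have "cmod (g z - h z) \<le> e / 2" if "z \<in> Cplus" for z
      using norm_triangle_ineq4[of "g z - resolvent_poly Q z" "h z - resolvent_poly Q z"] Q[OF that]
        h(2)[OF that]
      by simp
    then have "sup_norm (\<lambda>z. g z - h z) \<le> ennreal (e / 2)"
      by (simp add: sup_norm_le_iff ennreal_leI)
    also have "\<dots> < ennreal e" using \<open>e > 0\<close> by (intro ennreal_lessI) auto
    finally show ?thesis using h(1) by blast
  qed
  then show "g \<in> closure_sup Y" using g by (simp add: closure_sup_def)
qed

lemma closure_sup_LL1: "closure_sup LL1 = {f \<in> B_space. C0_cl f}"
proof (intro antisym closure_sup_subset_C0 C0_subset_closure_sup)
  show "(h \<longlongrightarrow> 0) (at_infinity_within Cplus)" if "h \<in> LL1" for h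
    using LL1_tendsto_0[OF that]
    by (rule tendsto_mono[rotated]) (intro inf_mono order_refl, simp add: Cplus_subset_Cplus_cl)
  show "\<exists>h\<in>LL1. \<forall>z\<in>Cplus. cmod (h z - resolvent_poly Q z) < e" if "e > 0" for Q e
    using resolvent_poly_in_LL1[of Q] that by (metis diff_self norm_zero)
qed

lemma closure_sup_R0: "closure_sup R0 = {f \<in> B_space. C0_cl f}"
proof (intro antisym closure_sup_subset_C0 C0_subset_closure_sup R0_tendsto_0)
  show "\<exists>h\<in>R0. \<forall>z\<in>Cplus. cmod (h z - resolvent_poly Q z) < e" if "e > 0" for Q e
    using resolvent_poly_in_R0[of Q] that by (auto intro!: bexI[of _ "resolvent_poly Q"])
qed

lemma closure_sup_J0: "closure_sup J0 = {f \<in> B_space. C0_cl f}"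
proof (intro antisym closure_sup_subset_C0 C0_subset_closure_sup J0_tendsto_0)
  show "\<exists>h\<in>J0. \<forall>z\<in>Cplus. cmod (h z - resolvent_poly Q z) < e" if "e > 0" for Q e
    using laplace_fun_J0_approx[OF integrable_resolvent_poly_density that, of Q]
    by (simp add: laplace_fun_resolvent_poly_density)
qed

theorem mainTheorem7:
  shows "(\<forall>Y\<in>{LM, LL1, LMd, LMs, R0, J0}. closure_B Y = closure_sup Y) \<and>
         (\<forall>Y\<in>{LL1, R0, J0}. closure_B Y = {f \<in> B_space. C0_cl f})"
  using LM_closures_eq LL1_closures_eq LMd_closures_eq LMs_closures_eq R0_closures_eq J0_closures_eq
    closure_sup_LL1 closure_sup_R0 closure_sup_J0
  by simp

end
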